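(* Let $\Omega\subset\mathbb{R}^n$ be a bounded domain and $\lambda>0$. Let $u$ be a positive locally Lipschitz function in $\Omega$. Then $u$ is a metric solution of $\min\{|\nabla u|-\lambda u,-\Delta_\infty u\}=0$ in $\Omega$ (with $\mathbf{X}=\mathbb{R}^n$) if and only if $u$ is a (Euclidean) viscosity solution of $\min\{|\nabla u|-\lambda u,-\Delta_\infty u\}=0$ in $\Omega$.
   Context: $\mathbb{R}^n$ carries the Euclidean metric $d(x,y)=|x-y|$; $B_r(x)$ is the open ball; $\mathcal{O}\subset\subset D$ means $\overline{\mathcal{O}}\subset D$. For $\varphi\in C^2$, $\Delta_\infty\varphi=\langle\nabla^2\varphi\nabla\varphi,\nabla\varphi\rangle$. $\infty$-superharmonic: for a bounded domain $D$, a function $v:D\to\mathbb{R}$ bounded from below is $\infty$-superharmonic in $D$ if for any $\hat{x}\in D$, $a\in\mathbb{R}$, $\kappa\le 0$ and any bounded open set $\mathcal{O}\subset\subset D$ with $\hat{x}\in D\setminus\mathcal{O}$, $v\ge a+\kappa d(\hat{x},\cdot)$ on $\partial\mathcal{O}$ implies $v\ge a+\kappa d(\hat{x},\cdot)$ in $\overline{\mathcal{O}}$. (Such functions are automatically locally Lipschitz.) Subslope: $|\nabla^-v|(x)=\limsup_{y\to x}\frac{\max\{v(x)-v(y),0\}}{d(x,y)}$ for locally Lipschitz $v$. Metric supersolution: a locally Lipschitz function $u$ in $\Omega$ that is $\infty$-superharmonic in $\Omega$ and satisfies $|\nabla^-u|\ge\lambda u$ everywhere in $\Omega$. Metric subsolution: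 a locally Lipschitz function $u$ in $\Omega$ such that whenever there exist $x_0\in\Omega$, small $r_0>0$ and an $\infty$-superharmonic function $v$ in $B_{r_0}(x_0)\subset\Omega$ such that $u-v$ attains a strict local maximum at $x_0$, one has $\lim_{r\to0+}\inf_{B_r(x_0)}|\nabla^-v|\le\lambda u(x_0)$. Metric solution: both a metric supersolution and a metric subsolution. Viscosity supersolution: a locally bounded lower semicontinuous $u:\Omega\to\mathbb{R}$ such that whenever $x_0\in\Omega$ and $\varphi\in C^2(\Omega)$ are such that $u-\varphi$ attains a strict local minimum at $x_0$, both $|\nabla\varphi(x_0)|\ge\lambda u(x_0)$ and $-\Delta_\infty\varphi(x_0)\ge0$ hold. Viscosity subsolution: a locally bounded upper semicontinuous $u:\Omega\to\mathbb{R}$ such that whenever $x_0\in\Omega$ and $\varphi\in C^2(\Omega)$ are such that $u-\varphi$ attains a strict local maximum at $x_0$, either $|\nabla\varphi(x_0)|\le\lambda u(x_0)$ or $-\Delta_\infty\varphi(x_0)\le0$ holds. Viscosity solution: $u\in C(\Omega)$ that is both a viscosity supersolution and a viscosity subsolution. *)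

theory Defs
  imports "HOL-Analysis.Analysis"
begin

text \<open>
  Functions on a set \<open>D\<close> are represented by total functions; every notion below depends only on
  the values on \<open>D\<close> whenever \<open>D\<close> is open.
\<close>

definition locally_lipschitz_on :: "'a::metric_space set \<Rightarrow> ('a \<Rightarrow> real) \<Rightarrow> bool" where
  "locally_lipschitz_on D u \<longleftrightarrow>
     (\<forall>x\<in>D. \<exists>r>0. \<exists>L. L-lipschitz_on (ball x r \<inter> D) u)"

definition locally_bounded_on :: "'a::metric_space set \<Rightarrow> ('a \<Rightarrow> real) \<Rightarrow> bool" where
  "locally_bounded_on D u \<longleftrightarrow> (\<forall>x\<in>D. \<exists>r>0. bounded (u ` (ball x r \<inter> D)))"

definition lsc_on :: "'a::topological_space set \<Rightarrow> ('a \<Rightarrow> real) \<Rightarrow> bool" where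
  "lsc_on D u \<longleftrightarrow> (\<forall>x\<in>D. \<forall>a<u x. \<forall>\<^sub>F y in at x within D. a < u y)"

definition usc_on :: "'a::topological_space set \<Rightarrow> ('a \<Rightarrow> real) \<Rightarrow> bool" where
  "usc_on D u \<longleftrightarrow> (\<forall>x\<in>D. \<forall>a>u x. \<forall>\<^sub>F y in at x within D. u y < a)"

text \<open>\<open>at x within D\<close> excludes \<open>x\<close> itself, so strict inequality is demanded only for \<open>y \<noteq> x\<close>.\<close>

definition strict_local_max_on :: "'a::topological_space set \<Rightarrow> ('a \<Rightarrow> real) \<Rightarrow> 'a \<Rightarrow> bool" where
  "strict_local_max_on D f x \<longleftrightarrow> x \<in> D \<and> (\<forall>\<^sub>F y in at x within D. f y < f x)"

definition strict_local_min_on :: "'a::topological_space set \<Rightarrow> ('a \<Rightarrow> real) \<Rightarrow> 'a \<Rightarrow> bool" where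
  "strict_local_min_on D f x \<longleftrightarrow> x \<in> D \<and> (\<forall>\<^sub>F y in at x within D. f x < f y)"


section \<open>Metric notions\<close>

definition infty_superharmonic :: "'a::metric_space set \<Rightarrow> ('a \<Rightarrow> real) \<Rightarrow> bool" where
  "infty_superharmonic D v \<longleftrightarrow>
     bdd_below (v ` D) \<and>
     (\<forall>z\<in>D. \<forall>a \<kappa> U. \<kappa> \<le> 0 \<longrightarrow> open U \<longrightarrow> bounded U \<longrightarrow> closure U \<subseteq> D \<longrightarrow> z \<notin> U \<longrightarrow>
        (\<forall>x\<in>frontier U. v x \<ge> a + \<kappa> * dist z x) \<longrightarrow>
        (\<forall>x\<in>closure U. v x \<ge> a + \<kappa> * dist z x))"

text \<open>
  The subslope takes extended real values, so that the upper limit, and the infima of subslopes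
  over balls, are meaningful without side conditions; it is finite where \<open>v\<close> is locally Lipschitz.
\<close>

definition subslope :: "('a::metric_space \<Rightarrow> real) \<Rightarrow> 'a \<Rightarrow> ereal" where
  "subslope v x = Limsup (at x) (\<lambda>y. ereal (max (v x - v y) 0 / dist x y))"

definition metric_supersolution :: "real \<Rightarrow> 'a::metric_space set \<Rightarrow> ('a \<Rightarrow> real) \<Rightarrow> bool" where
  "metric_supersolution lam \<Omega> u \<longleftrightarrow>
     locally_lipschitz_on \<Omega> u \<and> infty_superharmonic \<Omega> u \<and>
     (\<forall>x\<in>\<Omega>. subslope u x \<ge> ereal (lam * u x))"

definition metric_subsolution :: "real \<Rightarrow> 'a::metric_space set \<Rightarrow> ('a \<Rightarrow> real) \<Rightarrow> bool" where
  "metric_subsolution lam \<Omega> u \<longleftrightarrow>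
     locally_lipschitz_on \<Omega> u \<and>
     (\<forall>x0\<in>\<Omega>. \<forall>r0>0. \<forall>v.
        ball x0 r0 \<subseteq> \<Omega> \<longrightarrow> infty_superharmonic (ball x0 r0) v \<longrightarrow>
        strict_local_max_on (ball x0 r0) (\<lambda>x. u x - v x) x0 \<longrightarrow>
        (\<exists>l. ((\<lambda>r. INF x\<in>ball x0 r. subslope v x) \<longlongrightarrow> l) (at_right 0) \<and>
             l \<le> ereal (lam * u x0)))"

definition metric_solution :: "real \<Rightarrow> 'a::metric_space set \<Rightarrow> ('a \<Rightarrow> real) \<Rightarrow> bool" where
  "metric_solution lam \<Omega> u \<longleftrightarrow> metric_supersolution lam \<Omega> u \<and> metric_subsolution lam \<Omega> u"


section \<open>Euclidean viscosity notions\<close>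

definition gradient :: "('a::euclidean_space \<Rightarrow> real) \<Rightarrow> 'a \<Rightarrow> 'a" where
  "gradient \<phi> x = (THE g. GDERIV \<phi> x :> g)"

text \<open>Intended for open \<open>S\<close>; \<open>H x\<close> is the Hessian at \<open>x\<close>, viewed as a linear map.\<close>

definition C2_on :: "'a::euclidean_space set \<Rightarrow> ('a \<Rightarrow> real) \<Rightarrow> bool" where
  "C2_on S \<phi> \<longleftrightarrow>
     (\<exists>g. \<exists>H :: 'a \<Rightarrow> 'a \<Rightarrow>\<^sub>L 'a.
        (\<forall>x\<in>S. GDERIV \<phi> x :> g x) \<and>
        (\<forall>x\<in>S. (g has_derivative blinfun_apply (H x)) (at x)) \<and>
        continuous_on S H)"

definition infty_laplacian :: "('a::euclidean_space \<Rightarrow> real) \<Rightarrow> 'a \<Rightarrow> real" where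
  "infty_laplacian \<phi> x =
     frechet_derivative (gradient \<phi>) (at x) (gradient \<phi> x) \<bullet> gradient \<phi> x"

definition viscosity_supersolution ::
    "real \<Rightarrow> 'a::euclidean_space set \<Rightarrow> ('a \<Rightarrow> real) \<Rightarrow> bool" where
  "viscosity_supersolution lam \<Omega> u \<longleftrightarrow>
     locally_bounded_on \<Omega> u \<and> lsc_on \<Omega> u \<and>
     (\<forall>x0\<in>\<Omega>. \<forall>\<phi>. C2_on \<Omega> \<phi> \<longrightarrow> strict_local_min_on \<Omega> (\<lambda>x. u x - \<phi> x) x0 \<longrightarrow>
        norm (gradient \<phi> x0) \<ge> lam * u x0 \<and> - infty_laplacian \<phi> x0 \<ge> 0)"

definition viscosity_subsolution ::
    "real \<Rightarrow> 'a::euclidean_space set \<Rightarrow> ('a \<Rightarrow> real) \<Rightarrow> bool" where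
  "viscosity_subsolution lam \<Omega> u \<longleftrightarrow>
     locally_bounded_on \<Omega> u \<and> usc_on \<Omega> u \<and>
     (\<forall>x0\<in>\<Omega>. \<forall>\<phi>. C2_on \<Omega> \<phi> \<longrightarrow> strict_local_max_on \<Omega> (\<lambda>x. u x - \<phi> x) x0 \<longrightarrow>
        norm (gradient \<phi> x0) \<le> lam * u x0 \<or> - infty_laplacian \<phi> x0 \<le> 0)"

definition viscosity_solution ::
    "real \<Rightarrow> 'a::euclidean_space set \<Rightarrow> ('a \<Rightarrow> real) \<Rightarrow> bool" where
  "viscosity_solution lam \<Omega> u \<longleftrightarrow>
     continuous_on \<Omega> u \<and> viscosity_supersolution lam \<Omega> u \<and> viscosity_subsolution lam \<Omega> u"

end

theory Submission
  imports Defs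
begin

text \<open>
  The two notions agree separately for supersolutions and for subsolutions. The bridge in each
  direction is comparison with cones \<open>a + \<kappa> |x - z|\<close>: these have vanishing infinity
  Laplacian away from the vertex, and slope \<open>|\<kappa>|\<close>.

  Supersolutions. A function obeying comparison with cones from below that is touched from below by a
  smooth \<open>\<phi>\<close> satisfies the second-order inequality, since otherwise a cone with vertex close to the
  contact point fits strictly below \<open>\<phi>\<close> (\<open>infty_superharmonic_touched_below\<close>); at the contact point
  the subslope is at most the length of the gradient. Conversely, bending a cone slightly gives it a
  strict sign of the infinity Laplacian, so viscosity supersolutions obey comparison
  (\<open>viscosity_supersolution_imp_infty_superharmonic\<close>), and touching with a smoothed cone gives the
  lower bound on the subslope at every point (\<open>viscosity_supersolution_subslope_ge\<close>).

  Subsolutions. A smooth test function violating both viscosity alternatives is, on a small ball,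
  infinity superharmonic with large subslope (\<open>infty_superharmonic_of_smooth\<close>), hence
  is forbidden by the metric definition. The converse is a comparison principle between the subsolution
  \<open>u\<close> and a superharmonic \<open>v\<close> whose subslope exceeds \<open>lam * u\<close>. Instead of doubling variables
  it uses the finite-difference argument of Armstrong and Smart: comparison with cones says that
  the maxima of \<open>u\<close> over balls of radius \<open>0\<close>, \<open>\<epsilon>\<close> and \<open>2 \<epsilon>\<close> are midpoint convex where \<open>u\<close> increases
  steeply, and that the minima of \<open>v\<close> are midpoint concave. Together with the steep decrease of \<open>v\<close> these facts force
  the largest difference to occur near the boundary (\<open>max_displacement_near_boundary\<close>).
\<close>


section \<open>Smooth test functions\<close>

lemma GDERIV_unique:
  assumes "GDERIV f x :> a" "GDERIV f x :> b"
  shows "a = b"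
proof -
  have "(\<lambda>h. h \<bullet> a) = (\<lambda>h. h \<bullet> b)"
    using assms unfolding gderiv_def by (rule has_derivative_unique)
  then have "(a - b) \<bullet> a = (a - b) \<bullet> b"
    by metis
  then have "(a - b) \<bullet> (a - b) = 0"
    by (simp add: inner_diff_right)
  then show ?thesis by simp
qed

lemma gradient_eqI: "gradient f x = g" if "GDERIV f x :> g"
  unfolding gradient_def using that GDERIV_unique by blast

lemma infty_laplacian_eqI:
  fixes f :: "'a::euclidean_space \<Rightarrow> real"
  assumes "open S" "x \<in> S"
    and g: "\<And>y. y \<in> S \<Longrightarrow> GDERIV f y :> g y"
    and A: "(g has_derivative A) (at x)"
  shows "infty_laplacian f x = A (g x) \<bullet> g x"
proof -
  have "(gradient f has_derivative A) (at x)"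
    using has_derivative_transform_within_open[OF A assms(1,2)] g
    by (metis gradient_eqI)
  then show ?thesis
    unfolding infty_laplacian_def
    using g[OF \<open>x \<in> S\<close>] by (metis frechet_derivative_at gradient_eqI)
qed

lemma inner_diff_self: "(x - w) \<bullet> (x - w) = (dist w x)\<^sup>2" for x w :: "'a::real_inner"
  by (metis dist_commute dist_norm power2_norm_eq_inner)

text \<open>
  All test functions below are radial about some \<open>z\<close>, plus a multiple of \<open>|x - y|\<^sup>4\<close>. The quartic
  term makes a touching at \<open>y\<close> strict and leaves gradient and Hessian at \<open>y\<close> unchanged.
\<close>

lemma radial_test_function:
  fixes z y :: "'a::euclidean_space"  and c :: real
  assumes F: "\<And>s. s \<ge> 0 \<Longrightarrow> (F has_real_derivative F1 s) (at s)"
    and F1: "\<And>s. s \<ge> 0 \<Longrightarrow> (F1 has_real_derivative F2 s) (at s)"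
    and F2: "continuous_on {0..} F2"
  defines "\<phi> \<equiv> \<lambda>x. F ((x - z) \<bullet> (x - z)) + c * ((x - y) \<bullet> (x - y))\<^sup>2"
    and "q \<equiv> (y - z) \<bullet> (y - z)"
  shows "C2_on S \<phi>"
    and "gradient \<phi> y = (2 * F1 q) *\<^sub>R (y - z)"
    and "infty_laplacian \<phi> y = 4 * (F1 q)\<^sup>2 * q * (2 * F1 q + 4 * F2 q * q)"
proof -
  define g where "g x = (2 * F1 ((x - z) \<bullet> (x - z))) *\<^sub>R (x - z)
      + (4 * c * ((x - y) \<bullet> (x - y))) *\<^sub>R (x - y)" for x
  define h where "h x k = (2 * F1 ((x - z) \<bullet> (x - z))) *\<^sub>R k
      + (4 * F2 ((x - z) \<bullet> (x - z)) * ((x - z) \<bullet> k)) *\<^sub>R (x - z)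
      + (4 * c * ((x - y) \<bullet> (x - y))) *\<^sub>R k + (8 * c * ((x - y) \<bullet> k)) *\<^sub>R (x - y)" for x k
  have sq: "((\<lambda>x. (x - w) \<bullet> (x - w)) has_derivative (\<lambda>k. 2 * ((x - w) \<bullet> k))) (at x)" for w x :: 'a
    by (auto intro!: derivative_eq_intros simp: inner_commute)
  have dF: "((\<lambda>x. F ((x - z) \<bullet> (x - z))) has_derivative
      (\<lambda>k. F1 ((x - z) \<bullet> (x - z)) * (2 * ((x - z) \<bullet> k)))) (at x)" for x
    using has_derivative_compose[OF sq F[THEN has_field_derivative_imp_has_derivative]] by simp
  have dF1: "((\<lambda>x. F1 ((x - z) \<bullet> (x - z))) has_derivative
      (\<lambda>k. F2 ((x - z) \<bullet> (x - z)) * (2 * ((x - z) \<bullet> k)))) (at x)" for x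
    using has_derivative_compose[OF sq F1[THEN has_field_derivative_imp_has_derivative]] by simp
  have g: "GDERIV \<phi> x :> g x" for x
    unfolding gderiv_def \<phi>_def g_def
    by (rule has_derivative_eq_rhs[OF has_derivative_add[OF dF has_derivative_mult_right[OF
             has_derivative_power[OF sq]]]])
       (auto simp: fun_eq_iff inner_add_right inner_commute algebra_simps)
  have h: "(g has_derivative h x) (at x)" for x
    unfolding g_def h_def
    by (rule derivative_eq_intros dF1 sq refl)+
       (auto simp: fun_eq_iff algebra_simps)
  have bl: "bounded_linear (h x)" for x
    using h[of x] by (rule has_derivative_bounded_linear)
  have app: "blinfun_apply (Blinfun (h x)) = h x" for x
    using bl by (rule bounded_linear_Blinfun_apply)
  have F1c: "continuous_on {0..} F1"
    using F1 by (meson DERIV_continuous atLeast_iff continuous_at_imp_continuous_on)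
  have c1: "continuous_on S (\<lambda>x. F1 ((x - z) \<bullet> (x - z)))"
    by (rule continuous_on_compose2[OF F1c]) (auto intro!: continuous_intros)
  have c2: "continuous_on S (\<lambda>x. F2 ((x - z) \<bullet> (x - z)))"
    by (rule continuous_on_compose2[OF F2]) (auto intro!: continuous_intros)
  have "continuous_on S (\<lambda>x. Blinfun (h x))"
    by (rule continuous_on_blinfun_componentwise)
       (unfold app h_def, intro continuous_intros c1 c2)
  then show "C2_on S \<phi>"
    unfolding C2_on_def using g h app by metis
  show "gradient \<phi> y = (2 * F1 q) *\<^sub>R (y - z)"
    using gradient_eqI[OF g, of y] by (simp add: g_def q_def)
  show "infty_laplacian \<phi> y = 4 * (F1 q)\<^sup>2 * q * (2 * F1 q + 4 * F2 q * q)"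
    using infty_laplacian_eqI[OF open_UNIV UNIV_I g h, of y]
    by (simp add: g_def h_def q_def algebra_simps power2_eq_square)
qed

text \<open>
  The cubic Taylor polynomial of the square root at \<open>\<rho>\<^sup>2\<close>. Composed with the squared distance to
  \<open>z\<close> it replaces the distance to \<open>z\<close>, which is not differentiable at \<open>z\<close>, by a function that is
  smooth everywhere and agrees with it to second order on the sphere of radius \<open>\<rho>\<close>.
\<close>

definition sqrt_cubic :: "real \<Rightarrow> real \<Rightarrow> real" where
  "sqrt_cubic \<rho> s =
     \<rho> * (1 + (s / \<rho>\<^sup>2 - 1) / 2 - (s / \<rho>\<^sup>2 - 1)\<^sup>2 / 8 + (s / \<rho>\<^sup>2 - 1) ^ 3 / 16)"

lemma sqrt_cubic_touches [simp]: "\<rho> \<noteq> 0 \<Longrightarrow> sqrt_cubic \<rho> (\<rho>\<^sup>2) = \<rho>"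
  by (simp add: sqrt_cubic_def)

text \<open>
  With \<open>t = r / \<rho>\<close>, the difference is \<open>\<rho> (t - 1)\<^sup>4 (t\<^sup>2 + 4 t + 5) / 16\<close>, so the comparison is
  global in \<open>r\<close>.
\<close>

lemma sqrt_cubic_ge:
  assumes "\<rho> > 0" "r \<ge> 0"
  shows "r \<le> sqrt_cubic \<rho> (r\<^sup>2)"
proof -
  define t where "t = r / \<rho>"
  have t: "t \<ge> 0" and r: "r = \<rho> * t"
    using assms by (auto simp: t_def)
  have "1 + (t\<^sup>2 - 1) / 2 - (t\<^sup>2 - 1)\<^sup>2 / 8 + (t\<^sup>2 - 1) ^ 3 / 16 - t
      = (t - 1) ^ 4 * (t\<^sup>2 + 4 * t + 5) / 16"
    by (simp add: field_simps eval_nat_numeral)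
  moreover have "\<dots> \<ge> 0"
    using t by (intro divide_nonneg_pos mult_nonneg_nonneg) auto
  ultimately have "t \<le> 1 + (t\<^sup>2 - 1) / 2 - (t\<^sup>2 - 1)\<^sup>2 / 8 + (t\<^sup>2 - 1) ^ 3 / 16"
    by linarith
  moreover have "r\<^sup>2 / \<rho>\<^sup>2 = t\<^sup>2"
    by (simp add: t_def power_divide)
  ultimately show ?thesis
    unfolding sqrt_cubic_def r using assms by (simp add: power_mult_distrib)
qed

text \<open>
  A cone has radial second derivative zero, hence vanishing infinity Laplacian; the term in
  \<open>\<gamma>\<close> gives that Laplacian the sign of \<open>\<gamma>\<close> wherever the slope of the profile
  \<open>\<kappa> r + \<gamma> r\<^sup>2\<close> is nonzero.
\<close>

lemma cone_test_function:
  fixes z y :: "'a::euclidean_space" and \<kappa> \<gamma> c :: real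
  assumes "y \<noteq> z"
  defines "\<rho> \<equiv> dist z y"
  defines "\<phi> \<equiv> \<lambda>x. (\<kappa> * sqrt_cubic \<rho> ((x - z) \<bullet> (x - z)) + \<gamma> * ((x - z) \<bullet> (x - z)))
                  + c * ((x - y) \<bullet> (x - y))\<^sup>2"
  shows "C2_on S \<phi>"
    and "norm (gradient \<phi> y) = \<bar>\<kappa> + 2 * \<gamma> * \<rho>\<bar>"
    and "infty_laplacian \<phi> y = 2 * \<gamma> * (\<kappa> + 2 * \<gamma> * \<rho>)\<^sup>2"
proof -
  have \<rho>: "\<rho> > 0" using assms by (simp add: \<rho>_def)
  define w where "w s = s / \<rho>\<^sup>2 - 1" for s
  define e where "e = 1 / \<rho>\<^sup>2"
  define F1 where "F1 s = \<kappa> * \<rho> * (1 / 2 - w s / 4 + 3 * (w s)\<^sup>2 / 16) * e + \<gamma>" for s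
  define F2 where "F2 s = \<kappa> * \<rho> * (3 * w s / 8 - 1 / 4) * e * e" for s
  have w: "(w has_real_derivative e) (at s)" for s
    unfolding w_def e_def using \<rho> by (auto intro!: derivative_eq_intros simp: field_simps eval_nat_numeral)
  have F: "((\<lambda>s. \<kappa> * sqrt_cubic \<rho> s + \<gamma> * s) has_real_derivative F1 s) (at s)" for s
  proof -
    have "((\<lambda>v. \<kappa> * (\<rho> * (1 + v / 2 - v\<^sup>2 / 8 + v ^ 3 / 16))) has_real_derivative
        \<kappa> * \<rho> * (1 / 2 - v / 4 + 3 * v\<^sup>2 / 16)) (at v)" for v
      by (auto intro!: derivative_eq_intros simp: algebra_simps)
    from DERIV_add[OF DERIV_chain2[OF this w] DERIV_cmult_Id[of \<gamma>]]
    show ?thesis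
      by (simp add: sqrt_cubic_def F1_def w_def)
  qed
  have F1: "(F1 has_real_derivative F2 s) (at s)" for s
  proof -
    have "((\<lambda>v. \<kappa> * \<rho> * (1 / 2 - v / 4 + 3 * v\<^sup>2 / 16) * e + \<gamma>) has_real_derivative
        \<kappa> * \<rho> * (3 * v / 8 - 1 / 4) * e) (at v)" for v
      by (auto intro!: derivative_eq_intros simp: algebra_simps)
    from DERIV_chain2[OF this w] show ?thesis
      by (simp add: F1_def[abs_def] F2_def)
  qed
  have F2: "continuous_on {0..} F2"
    unfolding F2_def w_def by (intro continuous_intros) (use \<rho> in auto)
  note * = radial_test_function[of "\<lambda>s. \<kappa> * sqrt_cubic \<rho> s + \<gamma> * s" F1 F2, OF F F1 F2,
      where z = z and c = c and y = y, folded \<phi>_def]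
  show "C2_on S \<phi>" by (rule *(1))
  have q: "(y - z) \<bullet> (y - z) = \<rho>\<^sup>2"
    by (simp add: \<rho>_def dist_norm norm_minus_commute flip: power2_norm_eq_inner)
  have F1q: "2 * \<rho> * F1 (\<rho>\<^sup>2) = \<kappa> + 2 * \<gamma> * \<rho>"
    using \<rho> by (simp add: F1_def w_def e_def field_simps power2_eq_square)
  have F2q: "2 * F1 (\<rho>\<^sup>2) + 4 * F2 (\<rho>\<^sup>2) * \<rho>\<^sup>2 = 2 * \<gamma>"
    using \<rho> by (simp add: F1_def F2_def w_def e_def field_simps power2_eq_square)
  have "norm (gradient \<phi> y) = \<bar>2 * \<rho> * F1 (\<rho>\<^sup>2)\<bar>"
    using *(2) \<rho> by (simp add: q abs_mult) (simp add: \<rho>_def dist_norm norm_minus_commute)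
  then show "norm (gradient \<phi> y) = \<bar>\<kappa> + 2 * \<gamma> * \<rho>\<bar>"
    using F1q by simp
  have "infty_laplacian \<phi> y = (2 * \<rho> * F1 (\<rho>\<^sup>2))\<^sup>2 * (2 * F1 (\<rho>\<^sup>2) + 4 * F2 (\<rho>\<^sup>2) * \<rho>\<^sup>2)"
    using *(3) by (simp add: q power_mult_distrib)
  then show "infty_laplacian \<phi> y = 2 * \<gamma> * (\<kappa> + 2 * \<gamma> * \<rho>)\<^sup>2"
    unfolding F1q F2q by simp
qed


section \<open>Comparison with cones from below\<close>

lemma infty_superharmonicD:
  assumes "infty_superharmonic D v" "z \<in> D" "\<kappa> \<le> 0"
    and "open U" "bounded U" "closure U \<subseteq> D" "z \<notin> U"
    and "\<And>x. x \<in> frontier U \<Longrightarrow> a + \<kappa> * dist z x \<le> v x"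
    and "x \<in> closure U"
  shows "a + \<kappa> * dist z x \<le> v x"
  using assms unfolding infty_superharmonic_def by blast

text \<open>
  Comparison on the punctured ball, whose frontier consists of the sphere and the centre, with the cone
  that equals \<open>v\<close> at the centre and \<open>m\<close> on the sphere.
\<close>

lemma infty_superharmonic_cone_bound:
  fixes v :: "'a::euclidean_space \<Rightarrow> real"
  assumes v: "infty_superharmonic D v" and D: "cball z r \<subseteq> D" and "r > 0"
    and m: "m \<le> v z" "\<And>x. dist z x = r \<Longrightarrow> m \<le> v x"
    and x: "x \<in> cball z r"
  shows "v z - (v z - m) / r * dist z x \<le> v x"
proof (cases "x = z")
  case False
  define \<kappa> where "\<kappa> = - ((v z - m) / r)"
  have \<kappa>: "\<kappa> \<le> 0" using m(1) \<open>r > 0\<close> by (simp add: \<kappa>_def)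
  define U where "U = ball z r - {z}"
  have cl: "closure U \<subseteq> cball z r"
    unfolding U_def by (rule closure_minimal) auto
  have "open U" "bounded U" "z \<notin> U"
    by (auto simp: U_def intro: bounded_subset[OF bounded_ball])
  moreover have "v z + \<kappa> * dist z y \<le> v y" if "y \<in> frontier U" for y
  proof -
    have "y \<in> cball z r" "y \<notin> U"
      using that cl \<open>open U\<close> by (auto simp: frontier_def interior_open)
    then have "y = z \<or> dist z y = r" by (auto simp: U_def)
    then show ?thesis
      using m(2)[of y] \<open>r > 0\<close> by (auto simp: \<kappa>_def)
  qed
  moreover have "z \<in> D" using D \<open>r > 0\<close> by auto
  moreover have "closure U \<subseteq> D" using cl D by blast
  ultimately have cone: "v z + \<kappa> * dist z y \<le> v y" if "y \<in> closure U" for y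
    using infty_superharmonicD[OF v _ \<kappa>, of z U "v z" y] that by blast
  show ?thesis
  proof (cases "x \<in> ball z r")
    case True
    then have "x \<in> closure U"
      using False closure_subset[of U] by (auto simp: U_def)
    then show ?thesis using cone by (auto simp: \<kappa>_def)
  next
    case False
    then have "dist z x = r" using x by auto
    then show ?thesis using m(2) \<open>r > 0\<close> by simp
  qed
qed simp

text \<open>
  Continuity follows from the lower bound on \<open>v\<close>, because
  comparison bounds the slope of \<open>v\<close> by its height above that bound.
\<close>

lemma infty_superharmonic_continuous_on:
  fixes v :: "'a::euclidean_space \<Rightarrow> real"
  assumes v: "infty_superharmonic D v" and "open D"
  shows "continuous_on D v"
proof (rule continuous_at_imp_continuous_on, rule ballI)
  fix z assume "z \<in> D"
  obtain m where m: "\<And>x. x \<in> D \<Longrightarrow> m \<le> v x"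
    using v unfolding infty_superharmonic_def bdd_below_def by (metis imageI)
  obtain k where k: "k > 0" "cball z k \<subseteq> D"
    using \<open>open D\<close> \<open>z \<in> D\<close> open_contains_cball by blast
  define r where "r = k / 2"
  have "r > 0" using k by (simp add: r_def)
  have bound: "v w - (v w - m) / r * dist w x \<le> v x" if "dist z w \<le> r" "dist w x \<le> r" for w x
  proof (rule infty_superharmonic_cone_bound[OF v _ \<open>r > 0\<close>])
    show "cball w r \<subseteq> D"
    proof
      fix y assume "y \<in> cball w r"
      then have "dist z y \<le> k"
        using that dist_triangle[of z y w] by (simp add: r_def)
      then show "y \<in> D" using k by auto
    qed
    then have "m \<le> v y" if "dist w y \<le> r" for y
      using m that by auto
    then show "m \<le> v w" "\<And>y. dist w y = r \<Longrightarrow> m \<le> v y" "x \<in> cball w r"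
      using that \<open>r > 0\<close> by auto
  qed
  \<comment> \<open>The cone with vertex \<open>z\<close> bounds \<open>v x\<close> from below, the cone with vertex \<open>x\<close> from above.\<close>
  have near: "\<forall>\<^sub>F x in at z. dist z x < r"
    using \<open>r > 0\<close> unfolding eventually_at by (auto simp: dist_commute)
  have "(v \<longlongrightarrow> v z) (at z)"
  proof (rule tendsto_sandwich)
    show "\<forall>\<^sub>F x in at z. v z - (v z - m) / r * dist z x \<le> v x"
      using near by eventually_elim (use bound \<open>r > 0\<close> in auto)
    show "\<forall>\<^sub>F x in at z. v x \<le> m + (v z - m) / (1 - dist z x / r)"
      using near
    proof eventually_elim
      case (elim x)
      have "v x - (v x - m) / r * dist x z \<le> v z"
        using elim by (intro bound) (auto simp: dist_commute)
      then have "(v x - m) * (1 - dist z x / r) \<le> v z - m"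
        by (simp add: algebra_simps dist_commute)
      moreover have "1 - dist z x / r > 0"
        using elim \<open>r > 0\<close> by simp
      ultimately have "v x - m \<le> (v z - m) / (1 - dist z x / r)"
        by (simp add: pos_le_divide_eq)
      then show ?case by simp
    qed
    have "((\<lambda>x. v z - (v z - m) / r * dist z x) \<longlongrightarrow> v z - (v z - m) / r * dist z z) (at z)"
      by (intro tendsto_intros)
    then show "((\<lambda>x. v z - (v z - m) / r * dist z x) \<longlongrightarrow> v z) (at z)" by simp
    have "((\<lambda>x. m + (v z - m) / (1 - dist z x / r)) \<longlongrightarrow> m + (v z - m) / (1 - dist z z / r)) (at z)"
      by (intro tendsto_intros) (use \<open>r > 0\<close> in auto)
    then show "((\<lambda>x. m + (v z - m) / (1 - dist z x / r)) \<longlongrightarrow> v z) (at z)" by simp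
  qed
  then show "isCont v z" by (simp add: isCont_def)
qed

text \<open>
  For a superharmonic function the largest downward difference quotient over a sphere is
  nondecreasing in the radius, so every such quotient dominates the infinitesimal one.
\<close>

lemma subslope_le_difference_quotient:
  fixes v :: "'a::euclidean_space \<Rightarrow> real"
  assumes v: "infty_superharmonic D v" and D: "cball z r \<subseteq> D" and "r > 0"
    and m: "m \<le> v z" "\<And>x. dist z x = r \<Longrightarrow> m \<le> v x"
  shows "subslope v z \<le> ereal ((v z - m) / r)"
  unfolding subslope_def
proof (rule Limsup_bounded)
  have "\<forall>\<^sub>F x in at z. dist z x < r"
    using \<open>r > 0\<close> unfolding eventually_at by (auto simp: dist_commute)
  then show "\<forall>\<^sub>F x in at z. ereal (max (v z - v x) 0 / dist z x) \<le> ereal ((v z - m) / r)"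
    using eventually_neq_at_within[of z z UNIV]
  proof eventually_elim
    case (elim x)
    have "v z - (v z - m) / r * dist z x \<le> v x"
      using elim(1) by (intro infty_superharmonic_cone_bound[OF v D \<open>r > 0\<close> m]) auto
    moreover have "0 \<le> (v z - m) / r * dist z x"
      using m(1) \<open>r > 0\<close> by simp
    ultimately have "max (v z - v x) 0 \<le> (v z - m) / r * dist z x"
      by simp
    then show ?case
      using elim(2) by (simp add: pos_divide_le_eq)
  qed
qed


section \<open>Smooth functions and infinity superharmonicity\<close>

text \<open>
  The mean value theorem along the segment from \<open>x0\<close>, applied to \<open>\<phi>\<close> minus its quadratic
  expansion, reduces the claim to the definition of the derivative of \<open>g\<close>.
\<close>

lemma second_order_taylor:
  fixes \<phi> :: "'a::real_inner \<Rightarrow> real"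
  assumes "open S" "x0 \<in> S"
    and g: "\<And>x. x \<in> S \<Longrightarrow> GDERIV \<phi> x :> g x"
    and A: "(g has_derivative A) (at x0)" and "\<omega> > 0"
  obtains d where "d > 0" "ball x0 d \<subseteq> S"
    "\<And>h. norm h < d \<Longrightarrow> \<bar>\<phi> (x0 + h) - (\<phi> x0 + g x0 \<bullet> h + A h \<bullet> h / 2)\<bar> \<le> \<omega> * (norm h)\<^sup>2"
proof -
  obtain d1 where d1: "d1 > 0"
    "\<And>y. norm (y - x0) < d1 \<Longrightarrow> norm (g y - g x0 - A (y - x0)) \<le> \<omega> * norm (y - x0)"
    using A \<open>\<omega> > 0\<close> unfolding has_derivative_at_alt by blast
  obtain d2 where d2: "d2 > 0" "ball x0 d2 \<subseteq> S"
    using assms(1,2) open_contains_ball by blast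
  have lin: "A (s *\<^sub>R h) = s *\<^sub>R A h" for s h
    using A by (meson has_derivative_bounded_linear bounded_linear.linear linear_cmul)
  show ?thesis
  proof
    show "min d1 d2 > 0" using d1 d2 by simp
    show "ball x0 (min d1 d2) \<subseteq> S" using d2 by auto
    fix h :: 'a assume h: "norm h < min d1 d2"
    define F where "F s = \<phi> (x0 + s *\<^sub>R h) - s * (g x0 \<bullet> h) - s\<^sup>2 * (A h \<bullet> h / 2)" for s
    have small: "norm (s *\<^sub>R h) < min d1 d2" if "0 \<le> s" "s \<le> 1" for s
    proof -
      have "norm (s *\<^sub>R h) \<le> norm h"
        using that by (simp add: mult_left_le_one_le)
      then show ?thesis using h by linarith
    qed
    have dF: "(F has_real_derivative (g (x0 + s *\<^sub>R h) - g x0 - A (s *\<^sub>R h)) \<bullet> h) (at s)"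
      if "0 \<le> s" "s \<le> 1" for s
    proof -
      have "x0 + s *\<^sub>R h \<in> S"
        using small[OF that] d2 by (auto simp: dist_norm subset_iff)
      then have "(\<phi> has_derivative (\<lambda>k. k \<bullet> g (x0 + s *\<^sub>R h))) (at (x0 + s *\<^sub>R h))"
        using g unfolding gderiv_def by blast
      moreover have "((\<lambda>s. x0 + s *\<^sub>R h) has_derivative (\<lambda>t. t *\<^sub>R h)) (at s)"
        by (auto intro!: derivative_eq_intros)
      ultimately
      have "((\<lambda>s. \<phi> (x0 + s *\<^sub>R h)) has_derivative (\<lambda>t. (t *\<^sub>R h) \<bullet> g (x0 + s *\<^sub>R h))) (at s)"
        by (rule has_derivative_compose[rotated])
      then have "((\<lambda>s. \<phi> (x0 + s *\<^sub>R h)) has_real_derivative h \<bullet> g (x0 + s *\<^sub>R h)) (at s)"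
        unfolding has_field_derivative_def by (simp add: mult_commute_abs)
      then show ?thesis
        unfolding F_def
        by (auto intro!: derivative_eq_intros
            simp: lin inner_diff_left inner_commute algebra_simps)
    qed
    obtain s where s: "0 < s" "s < 1"
      "F 1 - F 0 = (1 - 0) * ((g (x0 + s *\<^sub>R h) - g x0 - A (s *\<^sub>R h)) \<bullet> h)"
      using MVT2[of 0 1 F, OF _ dF] by auto
    have "\<bar>F 1 - F 0\<bar> \<le> norm (g (x0 + s *\<^sub>R h) - g x0 - A (s *\<^sub>R h)) * norm h"
      using s(3) Cauchy_Schwarz_ineq2 by simp
    also have "\<dots> \<le> (\<omega> * norm (s *\<^sub>R h)) * norm h"
      using d1(2)[of "x0 + s *\<^sub>R h"] small[of s] s by (intro mult_right_mono) auto
    also have "\<dots> \<le> (\<omega> * norm h) * norm h"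
      using s \<open>\<omega> > 0\<close> by (intro mult_right_mono mult_left_mono) (auto simp: mult_left_le_one_le)
    finally show "\<bar>\<phi> (x0 + h) - (\<phi> x0 + g x0 \<bullet> h + A h \<bullet> h / 2)\<bar> \<le> \<omega> * (norm h)\<^sup>2"
      by (simp add: F_def power2_eq_square algebra_simps)
  qed
qed

text \<open>
  If the Hessian \<open>A\<close> were positive in the direction of the gradient \<open>p\<close>, take a cone of slope
  \<open>- |p|\<close> with vertex \<open>x0 + t p\<close>. Its gradient at \<open>x0\<close> is \<open>p\<close>; its Hessian vanishes along \<open>p\<close> and
  is as negative as desired orthogonally to \<open>p\<close> when \<open>t\<close> is small. Hence \<open>\<phi>\<close>, and so \<open>u\<close>, lies
  above the cone with a quadratic gap near \<open>x0\<close>, and the lifted cone violates comparison.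
\<close>

lemma infty_superharmonic_touched_below:
  fixes u :: "'a::euclidean_space \<Rightarrow> real"
  assumes u: "infty_superharmonic S u" and S: "open S" "x0 \<in> S"
    and g: "\<And>x. x \<in> S \<Longrightarrow> GDERIV \<phi> x :> g x"
    and A: "(g has_derivative A) (at x0)"
    and touch: "\<forall>\<^sub>F x in at x0. u x0 - \<phi> x0 \<le> u x - \<phi> x"
  shows "A (g x0) \<bullet> g x0 \<le> 0"
proof (rule ccontr)
  assume "\<not> ?thesis"
  then have "A (g x0) \<bullet> g x0 > 0" by simp
  interpret A: bounded_linear A
    using A by (rule has_derivative_bounded_linear)
  define b where "b = norm (g x0)"
  define e where "e = g x0 /\<^sub>R b"
  have b: "b > 0"
    using \<open>A (g x0) \<bullet> g x0 > 0\<close> by (auto simp: b_def A.zero)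
  have e: "norm e = 1" "g x0 = b *\<^sub>R e"
    using b by (auto simp: e_def b_def)
  have ee: "e \<bullet> e = 1" using e by (simp add: norm_eq_1)
  define a where "a = A e \<bullet> e"
  have a: "a > 0"
    using \<open>A (g x0) \<bullet> g x0 > 0\<close> b by (auto simp: a_def e A.scaleR zero_less_mult_iff)
  obtain M where M: "M > 0" "\<And>h. norm (A h) \<le> norm h * M"
    using A.pos_bounded by blast
  \<comment> \<open>\<open>K\<close> is the curvature in directions orthogonal to \<open>e\<close> that absorbs all terms of the Hessian
     except \<open>a\<close>; the vertex of the cone must be close enough to \<open>x0\<close> to provide it.\<close>
  define K where "K = M / 2 + M\<^sup>2 / a + a / 4"
  have K: "K > 0" using M a by (auto simp: K_def intro!: add_pos_pos)
  obtain d1 where d1: "d1 > 0" "ball x0 d1 \<subseteq> S"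
    "\<And>h. norm h < d1 \<Longrightarrow> \<bar>\<phi> (x0 + h) - (\<phi> x0 + g x0 \<bullet> h + A h \<bullet> h / 2)\<bar> \<le> a / 8 * (norm h)\<^sup>2"
    using second_order_taylor[OF S g A, of "a / 8"] a by (metis divide_pos_pos zero_less_numeral)
  obtain d2 where d2: "d2 > 0"
    "\<And>x. dist x x0 < d2 \<Longrightarrow> u x0 - \<phi> x0 \<le> u x - \<phi> x"
    using touch unfolding eventually_at by (metis order_refl UNIV_I)
  define t where "t = min (1 / (8 * K)) (d1 / (2 * b))"
  have t: "t > 0" using K d1 b by (simp add: t_def)
  have tK: "K \<le> 1 / (8 * t)"
  proof -
    have "t \<le> 1 / (8 * K)" by (simp add: t_def)
    then have "t * (8 * K) \<le> 1" using K by (simp add: field_simps)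
    then show ?thesis using t by (simp add: field_simps)
  qed
  have tb: "t * b < d1"
  proof -
    have "t * b \<le> d1 / (2 * b) * b" using b by (intro mult_right_mono) (auto simp: t_def)
    then show ?thesis using b d1 by simp
  qed
  have tbpos: "t * b > 0" using t b by simp
  define z where "z = x0 + (t * b) *\<^sub>R e"
  have zS: "z \<in> S"
    using tb d1(2) t b e by (auto simp: z_def dist_norm subset_iff)
  define d where "d = min (min d1 d2) (t * b / 2)"
  have d: "d > 0" "d \<le> d1" "d \<le> d2" "d \<le> t * b / 2"
    using d1 d2 t b by (auto simp: d_def)
  have cone: "\<phi> x0 + t * b\<^sup>2 + a / 8 * (norm h)\<^sup>2 \<le> \<phi> (x0 + h) + b * dist z (x0 + h)"
    if "norm h < d" for h
  proof -
    \<comment> \<open>Split the increment into its parts along and orthogonal to the gradient.\<close>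
    define \<alpha> where "\<alpha> = h \<bullet> e"
    define k where "k = h - \<alpha> *\<^sub>R e"
    have h: "h = \<alpha> *\<^sub>R e + k" by (simp add: k_def)
    have ke: "k \<bullet> e = 0" "e \<bullet> k = 0"
      by (auto simp: k_def \<alpha>_def ee inner_diff_left inner_diff_right inner_commute)
    have hh: "(norm h)\<^sup>2 = \<alpha>\<^sup>2 + (norm k)\<^sup>2"
    proof -
      have "h \<bullet> h = (\<alpha> *\<^sub>R e + k) \<bullet> (\<alpha> *\<^sub>R e + k)"
        using h by metis
      also have "\<dots> = \<alpha>\<^sup>2 + k \<bullet> k"
        by (simp add: ke ee inner_add_left inner_add_right power2_eq_square)
      finally show ?thesis
        unfolding power2_norm_eq_inner .
    qed
    have al: "\<bar>\<alpha>\<bar> \<le> norm h"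
      using Cauchy_Schwarz_ineq2[of h e] e by (simp add: \<alpha>_def)
    have kl: "norm k \<le> norm h"
      by (rule power2_le_imp_le) (simp_all add: hh)
    define T where "T = t * b - \<alpha>"
    have T: "T \<ge> t * b / 2" "T \<le> 2 * (t * b)"
      using al that d(4) norm_ge_zero[of h] unfolding T_def abs_le_iff by linarith+
    have tb0: "t * b > 0" and T0: "T > 0" using T(1) tbpos by linarith+
    have "dist z (x0 + h) = sqrt (T\<^sup>2 + (norm k)\<^sup>2)"
    proof -
      have "x0 + h - z = k - T *\<^sub>R e"
        by (simp add: z_def T_def h algebra_simps)
      then have "(dist z (x0 + h))\<^sup>2 = T\<^sup>2 + (norm k)\<^sup>2"
        unfolding dist_norm norm_minus_commute[of z] power2_norm_eq_inner
        by (simp add: inner_diff_left inner_diff_right ke ee power2_eq_square)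
      then show ?thesis by (metis real_sqrt_unique zero_le_dist)
    qed
    also have "\<dots> \<ge> T + (norm k)\<^sup>2 / (4 * T)"
    proof (rule real_le_rsqrt)
      have "norm k \<le> T" using kl that d T by linarith
      then have "(norm k)\<^sup>2 \<le> T\<^sup>2" by (intro power_mono) auto
      then have "(norm k)\<^sup>2 * (norm k)\<^sup>2 \<le> T\<^sup>2 * (norm k)\<^sup>2" by (intro mult_right_mono) auto
      then have "(norm k)\<^sup>2 * (norm k)\<^sup>2 / (16 * T\<^sup>2) \<le> T\<^sup>2 * (norm k)\<^sup>2 / (16 * T\<^sup>2)"
        by (intro divide_right_mono) auto
      moreover have "((norm k)\<^sup>2 / (4 * T))\<^sup>2 = (norm k)\<^sup>2 * (norm k)\<^sup>2 / (16 * T\<^sup>2)"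
        by (simp add: power2_eq_square)
      ultimately have "((norm k)\<^sup>2 / (4 * T))\<^sup>2 \<le> (norm k)\<^sup>2 / 16"
        using T0 by simp
      moreover have "(T + (norm k)\<^sup>2 / (4 * T))\<^sup>2 = T\<^sup>2 + (norm k)\<^sup>2 / 2 + ((norm k)\<^sup>2 / (4 * T))\<^sup>2"
        using T0 by (simp add: power2_sum)
      moreover have "(norm k)\<^sup>2 \<ge> 0" by simp
      ultimately show "(T + (norm k)\<^sup>2 / (4 * T))\<^sup>2 \<le> T\<^sup>2 + (norm k)\<^sup>2" by linarith
    qed
    finally have "b * (T + (norm k)\<^sup>2 / (4 * T)) \<le> b * dist z (x0 + h)"
      using b by simp
    moreover have "b * ((norm k)\<^sup>2 / (4 * T)) \<ge> (norm k)\<^sup>2 * K"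
    proof -
      have "(norm k)\<^sup>2 * K \<le> (norm k)\<^sup>2 * (1 / (8 * t))"
        using tK by (intro mult_left_mono) auto
      also have "\<dots> = b * ((norm k)\<^sup>2 / (4 * (2 * (t * b))))"
        using b t by (simp add: field_simps)
      also have "\<dots> \<le> b * ((norm k)\<^sup>2 / (4 * T))"
        by (intro mult_left_mono divide_left_mono mult_pos_pos T0 T(2) b t less_imp_le[OF b]) simp_all
      finally show ?thesis .
    qed
    ultimately have c1: "b * dist z (x0 + h) \<ge> t * b\<^sup>2 - b * \<alpha> + (norm k)\<^sup>2 * K"
      by (simp add: T_def algebra_simps power2_eq_square)
    have "A h \<bullet> h = \<alpha>\<^sup>2 * a + \<alpha> * (A e \<bullet> k) + \<alpha> * (A k \<bullet> e) + A k \<bullet> k"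
    proof -
      have "A h \<bullet> h = A (\<alpha> *\<^sub>R e + k) \<bullet> (\<alpha> *\<^sub>R e + k)"
        using h by metis
      then show ?thesis
        by (simp add: A.add A.scaleR inner_add_left inner_add_right a_def power2_eq_square algebra_simps)
    qed
    moreover have "\<alpha> * (A e \<bullet> k) \<ge> - (\<bar>\<alpha>\<bar> * (M * norm k))"
    proof -
      have "\<bar>A e \<bullet> k\<bar> \<le> norm (A e) * norm k" by (rule Cauchy_Schwarz_ineq2)
      also have "\<dots> \<le> M * norm k" using M(2)[of e] e by (intro mult_right_mono) auto
      finally have "\<bar>\<alpha> * (A e \<bullet> k)\<bar> \<le> \<bar>\<alpha>\<bar> * (M * norm k)"
        unfolding abs_mult by (intro mult_left_mono) auto
      then show ?thesis by linarith
    qed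
    moreover have "\<alpha> * (A k \<bullet> e) \<ge> - (\<bar>\<alpha>\<bar> * (M * norm k))"
    proof -
      have "\<bar>A k \<bullet> e\<bar> \<le> norm (A k) * norm e" by (rule Cauchy_Schwarz_ineq2)
      also have "\<dots> \<le> M * norm k" using M(2)[of k] e by (simp add: mult.commute)
      finally have "\<bar>\<alpha> * (A k \<bullet> e)\<bar> \<le> \<bar>\<alpha>\<bar> * (M * norm k)"
        unfolding abs_mult by (intro mult_left_mono) auto
      then show ?thesis by linarith
    qed
    moreover have "A k \<bullet> k \<ge> - (M * (norm k)\<^sup>2)"
    proof -
      have "\<bar>A k \<bullet> k\<bar> \<le> norm (A k) * norm k" by (rule Cauchy_Schwarz_ineq2)
      also have "\<dots> \<le> (norm k * M) * norm k" using M(2)[of k] by (intro mult_right_mono) auto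
      finally show ?thesis by (simp add: power2_eq_square abs_le_iff algebra_simps)
    qed
    moreover have "\<bar>\<alpha>\<bar> * (M * norm k) \<le> a / 4 * \<alpha>\<^sup>2 + M\<^sup>2 / a * (norm k)\<^sup>2"
    proof -
      have "0 \<le> (a * \<bar>\<alpha>\<bar> / 2 - M * norm k)\<^sup>2 / a" using a by simp
      also have "\<dots> = a / 4 * \<bar>\<alpha>\<bar>\<^sup>2 + M\<^sup>2 / a * (norm k)\<^sup>2 - \<bar>\<alpha>\<bar> * (M * norm k)"
        using a unfolding power2_eq_square by (simp add: field_simps)
      finally show ?thesis by simp
    qed
    ultimately have c2: "A h \<bullet> h / 2 \<ge> a / 4 * \<alpha>\<^sup>2 - (M\<^sup>2 / a + M / 2) * (norm k)\<^sup>2"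
      by (simp add: algebra_simps)
    have c3: "\<phi> (x0 + h) \<ge> \<phi> x0 + g x0 \<bullet> h + A h \<bullet> h / 2 - a / 8 * (norm h)\<^sup>2"
    proof -
      have "norm h < d1" using that d by simp
      from d1(3)[OF this] show ?thesis by linarith
    qed
    have c4: "g x0 \<bullet> h = b * \<alpha>"
      by (simp add: e(2) \<alpha>_def inner_commute)
    show ?thesis
      using c1 c2 c3 unfolding c4 hh K_def by (simp add: algebra_simps)
  qed
  define r where "r = d / 2"
  have r: "r > 0" "r < d" using d by (auto simp: r_def)
  \<comment> \<open>The touching cone, lifted by the amount that the quadratic gap leaves on the small sphere.\<close>
  define \<beta> where "\<beta> = u x0 + t * b\<^sup>2 + a / 8 * r\<^sup>2"
  have znot: "z \<notin> ball x0 r"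
    using r d tbpos e by (simp add: z_def dist_norm)
  have cl: "closure (ball x0 r) \<subseteq> S"
    using r d d1(2) by (auto simp: subset_iff)
  have fr: "\<beta> + - b * dist z x \<le> u x" if "x \<in> frontier (ball x0 r)" for x
  proof -
    have "norm (x - x0) = r"
      using that r by (simp add: dist_norm norm_minus_commute)
    then show ?thesis
      using cone[of "x - x0"] d2(2)[of x] r d by (simp add: \<beta>_def dist_norm)
  qed
  have "\<beta> + - b * dist z x0 \<le> u x0"
    by (rule infty_superharmonicD[OF u zS _ open_ball bounded_ball cl znot fr]) (use b r in auto)
  moreover have "dist z x0 = t * b"
    using t b e by (simp add: z_def dist_norm)
  moreover have "a / 8 * r\<^sup>2 > 0" using a r by simp
  ultimately show False
    by (simp add: \<beta>_def power2_eq_square)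
qed

text \<open>
  Near the contact point \<open>u\<close> decreases no faster than \<open>\<phi>\<close>.
\<close>

lemma subslope_le_of_touched_below:
  fixes u :: "'a::real_inner \<Rightarrow> real"
  assumes g: "GDERIV \<phi> x0 :> g"
    and touch: "\<forall>\<^sub>F x in at x0. u x0 - \<phi> x0 \<le> u x - \<phi> x"
  shows "subslope u x0 \<le> ereal (norm g)"
proof (rule ereal_le_epsilon2)
  fix \<epsilon> :: real assume "\<epsilon> > 0"
  obtain d where d: "d > 0"
    "\<And>y. norm (y - x0) < d \<Longrightarrow> norm (\<phi> y - \<phi> x0 - (y - x0) \<bullet> g) \<le> \<epsilon> * norm (y - x0)"
    using g \<open>\<epsilon> > 0\<close> unfolding gderiv_def has_derivative_at_alt by blast
  have "\<forall>\<^sub>F y in at x0. norm (y - x0) < d"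
    using d(1) unfolding eventually_at by (auto simp: dist_norm)
  then have "\<forall>\<^sub>F y in at x0. ereal (max (u x0 - u y) 0 / dist x0 y) \<le> ereal (norm g + \<epsilon>)"
    using touch eventually_neq_at_within[of x0 x0 UNIV]
  proof eventually_elim
    case (elim y)
    have "\<phi> x0 - \<phi> y \<le> - ((y - x0) \<bullet> g) + \<epsilon> * norm (y - x0)"
      using d(2)[OF elim(1)] by (simp add: abs_le_iff)
    also have "\<dots> \<le> (norm g + \<epsilon>) * dist x0 y"
      using Cauchy_Schwarz_ineq2[of "y - x0" g]
      by (simp add: abs_le_iff dist_norm norm_minus_commute algebra_simps)
    finally have "max (u x0 - u y) 0 \<le> (norm g + \<epsilon>) * dist x0 y"
      using elim(2) \<open>\<epsilon> > 0\<close> by simp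
    then show ?case
      using elim(3) by (simp add: divide_le_eq)
  qed
  then show "subslope u x0 \<le> ereal (norm g) + ereal \<epsilon>"
    unfolding subslope_def by (simp add: Limsup_bounded)
qed

text \<open>
  At an interior minimum of \<open>\<phi>\<close> minus a cone, the gradient of \<open>\<phi>\<close> is \<open>\<kappa>\<close> times the radial unit
  vector \<open>e\<close>, and the second derivative along \<open>e\<close> is nonnegative. So the infinity
  Laplacian of \<open>\<phi>\<close> there is nonnegative too, against the assumption.
\<close>

lemma infty_superharmonic_of_smooth:
  fixes \<phi> :: "'a::euclidean_space \<Rightarrow> real"
  assumes D: "open D" "bdd_below (\<phi> ` D)"
    and g: "\<And>x. x \<in> D \<Longrightarrow> GDERIV \<phi> x :> g x"
    and H: "\<And>x. x \<in> D \<Longrightarrow> (g has_derivative H x) (at x)"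
    and neg: "\<And>x. x \<in> D \<Longrightarrow> H x (g x) \<bullet> g x < 0"
  shows "infty_superharmonic D \<phi>"
  unfolding infty_superharmonic_def
proof (intro conjI D(2) ballI allI impI, rule ccontr)
  fix z a \<kappa> U x1
  assume "\<kappa> \<le> 0" and U: "open U" "bounded U" "closure U \<subseteq> D" and "z \<notin> U"
    and fr: "\<forall>x\<in>frontier U. a + \<kappa> * dist z x \<le> \<phi> x"
    and x1: "x1 \<in> closure U" and "\<not> a + \<kappa> * dist z x1 \<le> \<phi> x1"
  define f where "f x = \<phi> x - \<kappa> * norm (x - z)" for x
  have nd: "norm (x - z) = dist z x" for x
    by (simp add: dist_norm norm_minus_commute)
  have "continuous_on D \<phi>"
    using g unfolding gderiv_def
    by (meson continuous_at_imp_continuous_on has_derivative_continuous)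
  then have "continuous_on (closure U) f"
    unfolding f_def by (intro continuous_intros) (use U continuous_on_subset in blast)
  moreover have "compact (closure U)" "closure U \<noteq> {}"
    using U x1 by auto
  ultimately obtain y where y: "y \<in> closure U" "\<And>x. x \<in> closure U \<Longrightarrow> f y \<le> f x"
    using continuous_attains_inf[of "closure U" f] by auto
  have "y \<in> U"
  proof (rule ccontr)
    assume "y \<notin> U"
    then have "y \<in> frontier U"
      using y(1) U(1) by (simp add: frontier_def interior_open)
    then have "a \<le> f y"
      using fr by (simp add: f_def nd algebra_simps)
    moreover have "f x1 < a"
      using \<open>\<not> _ \<le> \<phi> x1\<close> by (simp add: f_def nd algebra_simps)
    ultimately show False
      using y(2)[OF x1] by simp
  qed
  then have "y \<noteq> z" "y \<in> D" using \<open>z \<notin> U\<close> y U by auto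
  obtain r where r: "r > 0" "ball y r \<subseteq> U"
    using U(1) \<open>y \<in> U\<close> open_contains_ball by blast
  define e where "e = sgn (y - z)"
  have e: "norm e = 1" using \<open>y \<noteq> z\<close> by (simp add: e_def norm_sgn)
  have "(f has_derivative (\<lambda>h. h \<bullet> (g y - \<kappa> *\<^sub>R e))) (at y)"
  proof -
    have "(norm has_derivative (\<lambda>h. h \<bullet> e)) (at (y - z))"
      unfolding e_def using \<open>y \<noteq> z\<close> by (intro has_derivative_norm) auto
    moreover have "((\<lambda>x. x - z) has_derivative (\<lambda>h. h)) (at y)"
      by (auto intro!: derivative_eq_intros)
    ultimately have "((\<lambda>x. norm (x - z)) has_derivative (\<lambda>h. h \<bullet> e)) (at y)"
      by (rule has_derivative_compose[rotated])
    moreover have "(\<phi> has_derivative (\<lambda>h. h \<bullet> g y)) (at y)"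
      using g[OF \<open>y \<in> D\<close>] by (simp add: gderiv_def)
    ultimately show ?thesis
      unfolding f_def by (auto intro!: derivative_eq_intros simp: inner_diff_right fun_eq_iff)
  qed
  then have "(\<lambda>h. h \<bullet> (g y - \<kappa> *\<^sub>R e)) = (\<lambda>h. 0)"
    by (rule differential_zero_maxmin[OF \<open>y \<in> U\<close> U(1)])
       (use y(2) closure_subset[of U] in blast)
  then have "(g y - \<kappa> *\<^sub>R e) \<bullet> (g y - \<kappa> *\<^sub>R e) = 0"
    by metis
  then have gy: "g y = \<kappa> *\<^sub>R e" by simp
  \<comment> \<open>The cone is affine along the ray \<open>e\<close>, so a negative second derivative of \<open>\<phi>\<close> in this
     direction is incompatible with a minimum.\<close>
  interpret L: bounded_linear "H y"
    using H[OF \<open>y \<in> D\<close>] by (rule has_derivative_bounded_linear)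
  define A where "A = H y e \<bullet> e"
  have "\<kappa> * \<kappa> * A < 0"
    using neg[OF \<open>y \<in> D\<close>] by (simp add: gy L.scaleR A_def mult.assoc)
  then have "A < 0"
    by (metis mult_nonneg_nonneg not_le zero_le_square)
  obtain d where d: "d > 0"
    "\<And>h. norm h < d \<Longrightarrow> \<bar>\<phi> (y + h) - (\<phi> y + g y \<bullet> h + H y h \<bullet> h / 2)\<bar> \<le> - A / 4 * (norm h)\<^sup>2"
    using second_order_taylor[OF D(1) \<open>y \<in> D\<close> g H[OF \<open>y \<in> D\<close>], of "- A / 4"] \<open>A < 0\<close>
    by (metis divide_pos_pos neg_0_less_iff_less zero_less_numeral)
  define s where "s = min d r / 2"
  have s: "s > 0" "s < d" "s < r" using d r by (auto simp: s_def)
  have "\<phi> (y + s *\<^sub>R e) \<le> \<phi> y + \<kappa> * s + A / 4 * s\<^sup>2"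
    using d(2)[of "s *\<^sub>R e"] s e
    by (simp add: gy L.scaleR abs_le_iff A_def[symmetric] power2_eq_square norm_eq_1 algebra_simps)
  moreover have "f y \<le> f (y + s *\<^sub>R e)"
  proof -
    have "y + s *\<^sub>R e \<in> ball y r" using s e by (simp add: dist_norm)
    then show ?thesis using y(2) r closure_subset[of U] by blast
  qed
  moreover have "norm (y + s *\<^sub>R e - z) = norm (y - z) + s"
  proof -
    have "y + s *\<^sub>R e - z = (norm (y - z) + s) *\<^sub>R e"
      using \<open>y \<noteq> z\<close> by (simp add: e_def sgn_div_norm algebra_simps)
    then show ?thesis using s e by simp
  qed
  moreover have "A / 4 * s\<^sup>2 < 0"
    using \<open>A < 0\<close> s by (simp add: mult_neg_pos)
  ultimately show False
    by (simp add: f_def algebra_simps)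
qed

lemma subslope_ge_norm_gradient:
  fixes \<phi> :: "'a::real_inner \<Rightarrow> real"
  assumes g: "GDERIV \<phi> x :> g" and "g \<noteq> 0"
  shows "ereal (norm g) \<le> subslope \<phi> x"
proof (rule ccontr)
  assume "\<not> ?thesis"
  then have "subslope \<phi> x < ereal (norm g)" by simp
  then obtain c' where c': "max 0 (subslope \<phi> x) < c'" "c' < ereal (norm g)"
    using dense[of "max 0 (subslope \<phi> x)" "ereal (norm g)"] \<open>g \<noteq> 0\<close> by auto
  obtain c where "c' = ereal c"
    using c' by (cases c') auto
  with c' have c: "subslope \<phi> x < ereal c" "c < norm g" by auto
  have "\<forall>\<^sub>F y in at x. ereal (max (\<phi> x - \<phi> y) 0 / dist x y) < ereal c"
    using c(1) unfolding subslope_def by (rule Limsup_lessD)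
  then obtain d1 where d1: "d1 > 0"
    "\<And>y. y \<noteq> x \<Longrightarrow> dist y x < d1 \<Longrightarrow> max (\<phi> x - \<phi> y) 0 / dist x y < c"
    unfolding eventually_at by auto
  have "norm g - c > 0" using c by simp
  then obtain d2 where d2: "d2 > 0"
    "\<And>y. norm (y - x) < d2 \<Longrightarrow> norm (\<phi> y - \<phi> x - (y - x) \<bullet> g) \<le> (norm g - c) * norm (y - x)"
    using g unfolding gderiv_def has_derivative_at_alt by blast
  define s where "s = min d1 d2 / 2"
  have s: "s > 0" "s < d1" "s < d2" using d1 d2 by (auto simp: s_def)
  define y where "y = x - s *\<^sub>R sgn g"
  have y: "norm (y - x) = s" "y \<noteq> x" "dist y x = s" "dist x y = s"
    using s \<open>g \<noteq> 0\<close> by (auto simp: y_def dist_norm norm_sgn sgn_zero_iff)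
  have "sgn g \<bullet> g = norm g"
    using \<open>g \<noteq> 0\<close> by (simp add: sgn_div_norm power2_norm_eq_inner[symmetric] power2_eq_square)
  then have "\<phi> x - \<phi> y \<ge> c * s"
    using d2(2)[of y] s y by (simp add: y_def abs_le_iff algebra_simps)
  moreover have "\<phi> x - \<phi> y < c * s"
    using d1(2)[of y] s y by (simp add: pos_divide_less_eq)
  ultimately show False by simp
qed


section \<open>Viscosity inequalities and cones\<close>

text \<open>
  The viscosity conditions may be tested with the perturbed cones \<open>\<kappa> r + \<gamma> r\<^sup>2\<close> away from the
  vertex, although these are not smooth on the whole domain and the contact need not be strict:
  the globally smooth function of \<open>cone_test_function\<close> replaces the cone from below when \<open>\<kappa> \<le> 0\<close>, and likewise from above
  in the next lemma when \<open>\<kappa> \<ge> 0\<close>.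
\<close>

lemma viscosity_supersolution_touching_cone:
  assumes u: "viscosity_supersolution lam \<Omega> u" and "y \<in> \<Omega>" "y \<noteq> z" "\<kappa> \<le> 0"
    and U: "open U" "y \<in> U"
    and min: "\<And>x. x \<in> U \<Longrightarrow> u y - (\<kappa> * dist z y + \<gamma> * (dist z y)\<^sup>2)
        \<le> u x - (\<kappa> * dist z x + \<gamma> * (dist z x)\<^sup>2)"
  shows "lam * u y \<le> \<bar>\<kappa> + 2 * \<gamma> * dist z y\<bar>"
    and "2 * \<gamma> * (\<kappa> + 2 * \<gamma> * dist z y)\<^sup>2 \<le> 0"
proof -
  define \<phi> where "\<phi> x = (\<kappa> * sqrt_cubic (dist z y) ((x - z) \<bullet> (x - z)) + \<gamma> * ((x - z) \<bullet> (x - z)))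
                  + - 1 * ((x - y) \<bullet> (x - y))\<^sup>2" for x
  note \<phi> = cone_test_function[OF \<open>y \<noteq> z\<close>, where \<kappa> = \<kappa> and \<gamma> = \<gamma> and c = "- 1", folded \<phi>_def]
  note sq = inner_diff_self
  have \<phi>y: "\<phi> y = \<kappa> * dist z y + \<gamma> * (dist z y)\<^sup>2"
    using \<open>y \<noteq> z\<close> by (simp add: \<phi>_def sq)
  have below: "\<phi> x < \<kappa> * dist z x + \<gamma> * (dist z x)\<^sup>2" if "x \<noteq> y" for x
  proof -
    have "\<kappa> * sqrt_cubic (dist z y) ((dist z x)\<^sup>2) \<le> \<kappa> * dist z x"
      using \<open>y \<noteq> z\<close> \<open>\<kappa> \<le> 0\<close> by (intro mult_left_mono_neg sqrt_cubic_ge) auto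
    moreover have "((x - y) \<bullet> (x - y))\<^sup>2 > 0"
      using that by simp
    ultimately show ?thesis
      unfolding \<phi>_def sq by linarith
  qed
  have "strict_local_min_on \<Omega> (\<lambda>x. u x - \<phi> x) y"
    unfolding strict_local_min_on_def eventually_at_topological
  proof (intro conjI exI[of _ U] ballI impI)
    fix x assume "x \<in> U" "x \<noteq> y" "x \<in> \<Omega>"
    then show "u y - \<phi> y < u x - \<phi> x"
      using min[of x] below[of x] \<phi>y by linarith
  qed (use U \<open>y \<in> \<Omega>\<close> in auto)
  with u \<phi>(1) \<open>y \<in> \<Omega>\<close>
  have "lam * u y \<le> norm (gradient \<phi> y)" "- infty_laplacian \<phi> y \<ge> 0"
    unfolding viscosity_supersolution_def by blast+
  then show "lam * u y \<le> \<bar>\<kappa> + 2 * \<gamma> * dist z y\<bar>"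
    and "2 * \<gamma> * (\<kappa> + 2 * \<gamma> * dist z y)\<^sup>2 \<le> 0"
    unfolding \<phi>(2,3) by auto
qed

lemma viscosity_subsolution_touching_cone:
  assumes u: "viscosity_subsolution lam \<Omega> u" and "y \<in> \<Omega>" "y \<noteq> z" "\<kappa> \<ge> 0"
    and U: "open U" "y \<in> U"
    and max: "\<And>x. x \<in> U \<Longrightarrow> u x - (\<kappa> * dist z x + \<gamma> * (dist z x)\<^sup>2)
        \<le> u y - (\<kappa> * dist z y + \<gamma> * (dist z y)\<^sup>2)"
  shows "\<bar>\<kappa> + 2 * \<gamma> * dist z y\<bar> \<le> lam * u y \<or> 0 \<le> 2 * \<gamma> * (\<kappa> + 2 * \<gamma> * dist z y)\<^sup>2"
proof -
  define \<phi> where "\<phi> x = (\<kappa> * sqrt_cubic (dist z y) ((x - z) \<bullet> (x - z)) + \<gamma> * ((x - z) \<bullet> (x - z)))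
                  + 1 * ((x - y) \<bullet> (x - y))\<^sup>2" for x
  note \<phi> = cone_test_function[OF \<open>y \<noteq> z\<close>, where \<kappa> = \<kappa> and \<gamma> = \<gamma> and c = 1, folded \<phi>_def]
  note sq = inner_diff_self
  have \<phi>y: "\<phi> y = \<kappa> * dist z y + \<gamma> * (dist z y)\<^sup>2"
    using \<open>y \<noteq> z\<close> by (simp add: \<phi>_def sq)
  have above: "\<kappa> * dist z x + \<gamma> * (dist z x)\<^sup>2 < \<phi> x" if "x \<noteq> y" for x
  proof -
    have "\<kappa> * dist z x \<le> \<kappa> * sqrt_cubic (dist z y) ((dist z x)\<^sup>2)"
      using \<open>y \<noteq> z\<close> \<open>\<kappa> \<ge> 0\<close> by (intro mult_left_mono sqrt_cubic_ge) auto
    moreover have "((x - y) \<bullet> (x - y))\<^sup>2 > 0"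
      using that by simp
    ultimately show ?thesis
      unfolding \<phi>_def sq by linarith
  qed
  have "strict_local_max_on \<Omega> (\<lambda>x. u x - \<phi> x) y"
    unfolding strict_local_max_on_def eventually_at_topological
  proof (intro conjI exI[of _ U] ballI impI)
    fix x assume "x \<in> U" "x \<noteq> y" "x \<in> \<Omega>"
    then show "u x - \<phi> x < u y - \<phi> y"
      using max[of x] above[of x] \<phi>y by linarith
  qed (use U \<open>y \<in> \<Omega>\<close> in auto)
  with u \<phi>(1) \<open>y \<in> \<Omega>\<close>
  have "norm (gradient \<phi> y) \<le> lam * u y \<or> - infty_laplacian \<phi> y \<le> 0"
    unfolding viscosity_subsolution_def by blast
  then show ?thesis
    unfolding \<phi>(2,3) by auto
qed

text \<open>
  If comparison with \<open>a + \<kappa> r\<close> fails in \<open>U\<close>, then \<open>u\<close> minus the perturbed cone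
  \<open>\<kappa> r + \<gamma> r\<^sup>2\<close> has a minimum inside \<open>U\<close> for small \<open>\<gamma> > 0\<close>, where the perturbed cone has
  positive infinity Laplacian.
\<close>

lemma viscosity_supersolution_imp_infty_superharmonic:
  fixes u :: "'a::euclidean_space \<Rightarrow> real"
  assumes u: "viscosity_supersolution lam \<Omega> u"
    and cont: "continuous_on \<Omega> u" and bdd: "bdd_below (u ` \<Omega>)"
  shows "infty_superharmonic \<Omega> u"
  unfolding infty_superharmonic_def
proof (intro conjI bdd ballI allI impI, rule ccontr)
  fix z a \<kappa> U x1
  assume "\<kappa> \<le> 0" and U: "open U" "bounded U" "closure U \<subseteq> \<Omega>" and "z \<notin> U"
    and fr: "\<forall>x\<in>frontier U. a + \<kappa> * dist z x \<le> u x"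
    and x1: "x1 \<in> closure U" and "\<not> a + \<kappa> * dist z x1 \<le> u x1"
  define \<delta> where "\<delta> = a + \<kappa> * dist z x1 - u x1"
  have \<delta>: "\<delta> > 0"
    using \<open>\<not> _ \<le> u x1\<close> by (simp add: \<delta>_def)
  have cpt: "compact (closure U)"
    using U by simp
  obtain R where R: "R > 0" "\<And>x. x \<in> closure U \<Longrightarrow> dist z x \<le> R"
    using compact_imp_bounded[OF cpt] bounded_any_center[of "closure U" z]
    by (metis dist_commute gt_ex le_less_trans less_le not_le order_trans)
  \<comment> \<open>The first bound keeps the perturbed cone below \<open>u\<close> on the frontier up to less than \<open>\<delta>\<close>;
     the second keeps its slope nonzero.\<close>
  define \<gamma> where "\<gamma> = min (\<delta> / (2 * R\<^sup>2)) (if \<kappa> < 0 then - \<kappa> / (4 * R) else 1)"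
  have \<gamma>: "\<gamma> > 0"
    using \<delta> R by (auto simp: \<gamma>_def divide_neg_pos)
  have "\<gamma> * R\<^sup>2 \<le> \<delta> / (2 * R\<^sup>2) * R\<^sup>2"
    by (intro mult_right_mono) (auto simp: \<gamma>_def)
  then have \<gamma>R2: "\<gamma> * R\<^sup>2 < \<delta>"
    using R \<delta> by simp
  have \<gamma>R: "\<kappa> + 2 * \<gamma> * R < 0" if "\<kappa> < 0"
  proof -
    have "\<gamma> * R \<le> - \<kappa> / (4 * R) * R"
      using R that by (intro mult_right_mono) (auto simp: \<gamma>_def)
    then show ?thesis using R that by simp
  qed
  define f where "f x = u x - (\<kappa> * dist z x + \<gamma> * (dist z x)\<^sup>2)" for x
  have "continuous_on (closure U) f"
    unfolding f_def
    by (intro continuous_intros continuous_on_subset[OF cont]) (use U in auto)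
  then obtain y where y: "y \<in> closure U" "\<And>x. x \<in> closure U \<Longrightarrow> f y \<le> f x"
    using continuous_attains_inf[OF cpt, of f] x1 by (metis empty_iff)
  have "f y \<le> a - \<delta>"
  proof -
    have "f x1 \<le> a - \<delta>"
      using \<gamma> by (simp add: f_def \<delta>_def)
    then show ?thesis using y(2)[OF x1] by simp
  qed
  have "y \<in> U"
  proof (rule ccontr)
    assume "y \<notin> U"
    then have "y \<in> frontier U"
      using y(1) U(1) by (simp add: frontier_def interior_open)
    then have "a + \<kappa> * dist z y \<le> u y"
      using fr by blast
    moreover have "\<gamma> * (dist z y)\<^sup>2 \<le> \<gamma> * R\<^sup>2"
      using R(2)[OF y(1)] \<gamma> by (intro mult_left_mono power_mono) auto
    ultimately show False
      using \<open>f y \<le> a - \<delta>\<close> \<gamma>R2 by (simp add: f_def)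
  qed
  then have "y \<noteq> z" using \<open>z \<notin> U\<close> by blast
  have "2 * \<gamma> * (\<kappa> + 2 * \<gamma> * dist z y)\<^sup>2 \<le> 0"
  proof (rule viscosity_supersolution_touching_cone(2)[OF u _ \<open>y \<noteq> z\<close> \<open>\<kappa> \<le> 0\<close> U(1) \<open>y \<in> U\<close>])
    show "y \<in> \<Omega>" using y(1) U by blast
    show "u y - (\<kappa> * dist z y + \<gamma> * (dist z y)\<^sup>2) \<le> u x - (\<kappa> * dist z x + \<gamma> * (dist z x)\<^sup>2)"
      if "x \<in> U" for x
      using y(2)[of x] that closure_subset[of U] by (auto simp: f_def)
  qed
  then have "\<kappa> + 2 * \<gamma> * dist z y = 0"
    using \<gamma> by (simp add: mult_le_0_iff)
  moreover have "\<gamma> * dist z y \<le> \<gamma> * R"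
    using R(2)[OF y(1)] \<gamma> by simp
  moreover have "\<gamma> * dist z y > 0"
    using \<gamma> \<open>y \<noteq> z\<close> by simp
  ultimately show False
    using \<gamma>R \<open>\<kappa> \<le> 0\<close> by (cases "\<kappa> < 0") auto
qed

text \<open>
  If the subslope were less than \<open>c < lam * u x0\<close>, then \<open>u\<close> would drop by at most \<open>c r\<close> on a small
  sphere about \<open>x0\<close>. The smoothed cone \<open>- c2 \<surd>(|x - x0|\<^sup>2 + \<eta>\<^sup>2)\<close> with \<open>c2\<close> slightly above \<open>c\<close> drops
  more, so it touches \<open>u\<close> from below inside the ball, with gradient of norm at most \<open>c2\<close>. That is
  too small for the gradient inequality.
\<close>

lemma viscosity_supersolution_subslope_ge:
  fixes u :: "'a::euclidean_space \<Rightarrow> real"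
  assumes u: "viscosity_supersolution lam \<Omega> u" and "open \<Omega>"
    and cont: "continuous_on \<Omega> u" and "x0 \<in> \<Omega>" and pos: "lam * u x0 > 0"
  shows "ereal (lam * u x0) \<le> subslope u x0"
proof (rule ccontr)
  assume "\<not> ?thesis"
  then have "subslope u x0 < ereal (lam * u x0)" by simp
  with pos have "max 0 (subslope u x0) < ereal (lam * u x0)" by simp
  then obtain c' where c': "max 0 (subslope u x0) < c'" "c' < ereal (lam * u x0)"
    using dense by blast
  obtain c where "c' = ereal c"
    using c' by (cases c') auto
  with c' have c: "0 < c" "subslope u x0 < ereal c" "c < lam * u x0" by auto
  from c obtain c2 where c2: "c < c2" "c2 < lam * u x0" using dense by blast
  have "\<forall>\<^sub>F y in at x0. ereal (max (u x0 - u y) 0 / dist x0 y) < ereal c"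
    using c(2) unfolding subslope_def by (rule Limsup_lessD)
  then obtain d where d: "d > 0"
    "\<And>y. y \<noteq> x0 \<Longrightarrow> dist y x0 < d \<Longrightarrow> max (u x0 - u y) 0 / dist x0 y < c"
    unfolding eventually_at by auto
  have "isCont u x0"
    using cont \<open>open \<Omega>\<close> \<open>x0 \<in> \<Omega>\<close> by (simp add: continuous_on_eq_continuous_at)
  then have "((\<lambda>x. lam * u x) \<longlongrightarrow> lam * u x0) (at x0)"
    unfolding isCont_def by (intro tendsto_intros)
  then have "\<forall>\<^sub>F x in at x0. c2 < lam * u x"
    using c2(2) by (rule order_tendstoD)
  then obtain e where e: "e > 0" "\<And>x. x \<noteq> x0 \<Longrightarrow> dist x x0 < e \<Longrightarrow> c2 < lam * u x"
    unfolding eventually_at by auto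
  obtain k where k: "k > 0" "cball x0 k \<subseteq> \<Omega>"
    using \<open>open \<Omega>\<close> \<open>x0 \<in> \<Omega>\<close> open_contains_cball by blast
  define r where "r = min k (min d e / 2)"
  have r: "r > 0" "r < d" "r < e" "cball x0 r \<subseteq> \<Omega>"
    using d e k by (auto simp: r_def)
  have big: "c2 < lam * u x" if "x \<in> cball x0 r" for x
    using that e(2)[of x] c2 r by (cases "x = x0") (auto simp: dist_commute)
  have sph: "u x0 - c * r \<le> u x" if "dist x0 x = r" for x
    using d(2)[of x] that r by (auto simp: dist_commute field_simps)
  \<comment> \<open>Chosen so that the smoothed cone of slope \<open>c2\<close> still drops by more than \<open>c * r\<close>
     between the centre and the sphere.\<close>
  define \<eta> where "\<eta> = (c2 - c) * r / (2 * c2)"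
  have \<eta>: "\<eta> > 0" using c c2 r by (simp add: \<eta>_def)
  have \<eta>2: "c2 * \<eta> < (c2 - c) * r" using c c2 r by (simp add: \<eta>_def)
  define f where "f x = u x + c2 * sqrt ((dist x0 x)\<^sup>2 + \<eta>\<^sup>2)" for x
  have "continuous_on (cball x0 r) f"
    unfolding f_def by (intro continuous_intros continuous_on_subset[OF cont] r)
  then obtain y where y: "y \<in> cball x0 r" "\<And>x. x \<in> cball x0 r \<Longrightarrow> f y \<le> f x"
    using continuous_attains_inf[OF compact_cball, of x0 r f] r by auto
  have "y \<in> ball x0 r"
  proof (rule ccontr)
    assume "y \<notin> ball x0 r"
    then have "dist x0 y = r" using y by auto
    then have "u x0 - c * r + c2 * r \<le> f y"
      using sph[of y] c c2 r unfolding f_def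
      by (intro add_mono mult_left_mono) (auto intro: real_le_rsqrt)
    moreover have "f y \<le> u x0 + c2 * \<eta>"
      using y(2)[of x0] r \<eta> by (simp add: f_def)
    ultimately show False using \<eta>2 by (simp add: algebra_simps)
  qed
  have "y \<in> \<Omega>" using y r by blast
  note sq = inner_diff_self
  define F where "F s = - c2 * sqrt (s + \<eta>\<^sup>2)" for s
  define F1 where "F1 s = - c2 / 2 * inverse (sqrt (s + \<eta>\<^sup>2))" for s
  define F2 where "F2 s = c2 / 4 * inverse (sqrt (s + \<eta>\<^sup>2)) * inverse (s + \<eta>\<^sup>2)" for s
  have pos\<eta>: "s + \<eta>\<^sup>2 > 0" if "s \<ge> 0" for s
    using that \<eta> by (simp add: add_nonneg_pos)
  have dF: "(F has_real_derivative F1 s) (at s)" if "s \<ge> 0" for s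
    unfolding F_def F1_def using pos\<eta>[OF that]
    by (auto intro!: derivative_eq_intros simp: field_simps)
  have dF1: "(F1 has_real_derivative F2 s) (at s)" if "s \<ge> 0" for s
    unfolding F1_def F2_def using pos\<eta>[OF that]
    by (auto intro!: derivative_eq_intros simp: field_simps)
  have cF2: "continuous_on {0..} F2"
    unfolding F2_def by (intro continuous_intros) (use pos\<eta> in \<open>auto simp: less_imp_neq[symmetric]\<close>)
  define \<phi> where "\<phi> x = F ((x - x0) \<bullet> (x - x0)) + - 1 * ((x - y) \<bullet> (x - y))\<^sup>2" for x
  note \<phi> = radial_test_function[OF dF dF1 cF2, where z = x0 and y = y and c = "- 1", folded \<phi>_def]
  have "strict_local_min_on \<Omega> (\<lambda>x. u x - \<phi> x) y"
    unfolding strict_local_min_on_def eventually_at_topological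
  proof (intro conjI exI[of _ "ball x0 r"] ballI impI)
    fix x assume x: "x \<in> ball x0 r" "x \<noteq> y"
    have eq: "u x - \<phi> x = f x + ((x - y) \<bullet> (x - y))\<^sup>2" for x
      unfolding \<phi>_def f_def F_def sq by simp
    have "((x - y) \<bullet> (x - y))\<^sup>2 > 0"
      using \<open>x \<noteq> y\<close> by simp
    moreover have "f y \<le> f x"
      using y(2)[of x] x by simp
    moreover have "u y - \<phi> y = f y"
      unfolding eq by simp
    ultimately show "u y - \<phi> y < u x - \<phi> x"
      using eq[of x] by linarith
  qed (use \<open>y \<in> \<Omega>\<close> \<open>y \<in> ball x0 r\<close> in auto)
  then have "lam * u y \<le> norm (gradient \<phi> y)"
    using u \<phi>(1) \<open>y \<in> \<Omega>\<close> unfolding viscosity_supersolution_def by blast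
  also have "norm (gradient \<phi> y) = c2 * (dist x0 y / sqrt ((dist x0 y)\<^sup>2 + \<eta>\<^sup>2))"
    using c c2 by (simp add: \<phi>(2) sq F1_def abs_mult)
                  (simp add: dist_norm norm_minus_commute divide_inverse)
  also have "\<dots> \<le> c2 * 1"
    using c c2 pos\<eta>[of "(dist x0 y)\<^sup>2"]
    by (intro mult_left_mono) (auto simp: divide_le_eq intro: real_le_rsqrt)
  finally show False using big[OF y(1)] by simp
qed

text \<open>
  Where \<open>lam * u \<le> \<mu>\<close>, a subsolution cannot be touched from above by a function with slope
  greater than \<open>\<mu>\<close> and negative infinity Laplacian. Steep cones, bent slightly downwards,
  are such functions.
\<close>

lemma viscosity_subsolution_cone_bound:
  fixes u :: "'a::euclidean_space \<Rightarrow> real"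
  assumes u: "viscosity_subsolution lam \<Omega> u" and cont: "continuous_on (cball z r) u"
    and \<Omega>: "cball z r \<subseteq> \<Omega>" and "r > 0"
    and small: "\<And>y. y \<in> cball z r \<Longrightarrow> lam * u y \<le> \<mu>" and b: "0 \<le> \<mu>" "\<mu> < b"
    and sph: "\<And>y. dist z y = r \<Longrightarrow> u y \<le> u z + b * r"
    and x: "x \<in> cball z r"
  shows "u x \<le> u z + b * dist z x"
proof (rule ccontr)
  assume less: "\<not> ?thesis"
  define \<delta> where "\<delta> = u x - (u z + b * dist z x)"
  have \<delta>: "\<delta> > 0" using less by (simp add: \<delta>_def)
  \<comment> \<open>Small enough to keep the maximum off the sphere and the slope above \<open>\<mu>\<close>.\<close>
  define \<gamma> where "\<gamma> = min (\<delta> / (2 * r\<^sup>2)) ((b - \<mu>) / (4 * r))"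
  have \<gamma>: "\<gamma> > 0" using \<delta> b \<open>r > 0\<close> by (simp add: \<gamma>_def)
  have "\<gamma> * r\<^sup>2 \<le> \<delta> / (2 * r\<^sup>2) * r\<^sup>2"
    by (intro mult_right_mono) (auto simp: \<gamma>_def)
  then have \<gamma>r2: "\<gamma> * r\<^sup>2 < \<delta>"
    using \<open>r > 0\<close> \<delta> by simp
  have "\<gamma> * r \<le> (b - \<mu>) / (4 * r) * r"
    using \<open>r > 0\<close> by (intro mult_right_mono) (auto simp: \<gamma>_def)
  then have \<gamma>r: "2 * \<gamma> * r < b - \<mu>"
    using \<open>r > 0\<close> b by simp
  define f where "f y = u y - (b * dist z y + - \<gamma> * (dist z y)\<^sup>2)" for y
  have "continuous_on (cball z r) f"
    unfolding f_def by (intro continuous_intros cont)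
  then obtain y where y: "y \<in> cball z r" "\<And>w. w \<in> cball z r \<Longrightarrow> f w \<le> f y"
    using continuous_attains_sup[OF compact_cball, of z r f] \<open>r > 0\<close> by auto
  have fy: "u z + \<delta> \<le> f y"
  proof -
    have "u z + \<delta> \<le> f x" using \<gamma> by (simp add: f_def \<delta>_def)
    then show ?thesis using y(2)[OF x] by simp
  qed
  have "y \<noteq> z" using fy \<delta> by (auto simp: f_def)
  have "dist z y \<noteq> r"
    using fy \<gamma>r2 sph[of y] by (auto simp: f_def)
  then have "y \<in> ball z r" using y by auto
  have "y \<in> \<Omega>" using y \<Omega> by blast
  have "\<bar>b + 2 * - \<gamma> * dist z y\<bar> \<le> lam * u y \<or> 0 \<le> 2 * - \<gamma> * (b + 2 * - \<gamma> * dist z y)\<^sup>2"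
  proof (rule viscosity_subsolution_touching_cone[OF u \<open>y \<in> \<Omega>\<close> \<open>y \<noteq> z\<close> _ open_ball \<open>y \<in> ball z r\<close>])
    show "u w - (b * dist z w + - \<gamma> * (dist z w)\<^sup>2) \<le> u y - (b * dist z y + - \<gamma> * (dist z y)\<^sup>2)"
      if "w \<in> ball z r" for w
      using y(2)[of w] that by (simp add: f_def)
  qed (use b in auto)
  moreover have slope: "\<mu> < b + 2 * - \<gamma> * dist z y"
  proof -
    have "\<gamma> * dist z y \<le> \<gamma> * r" using y \<gamma> by simp
    then show ?thesis using \<gamma>r by simp
  qed
  moreover have "2 * - \<gamma> * (b + 2 * - \<gamma> * dist z y)\<^sup>2 < 0"
  proof -
    have "(b + 2 * - \<gamma> * dist z y)\<^sup>2 > 0"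
      using slope b(1) by (intro zero_less_power) linarith
    then show ?thesis using \<gamma> by (simp add: mult_less_0_iff)
  qed
  ultimately show False
    using small[OF y(1)] by linarith
qed


section \<open>A finite-difference comparison principle\<close>

text \<open>
  A discrete comparison principle after Armstrong and Smart. The assumption on \<open>u\<close> says that \<open>u\<close>
  satisfies midpoint convexity of its maxima over balls wherever it increases steeply; the one on
  \<open>v\<close> that the minima are midpoint concave and that \<open>v\<close> always decreases steeply. The maximum
  of \<open>u y - v y'\<close> over all pairs in a common \<open>\<epsilon>\<close>-ball is then attained near the boundary: at a
  maximiser further inside with the largest \<open>u y\<close>, moving on to the best point within
  \<open>2 * \<epsilon>\<close> would give another maximiser with a still larger value.
\<close>

lemma max_displacement_near_boundary:
  fixes u v :: "'a::euclidean_space \<Rightarrow> real"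
  assumes R: "0 < \<epsilon>" "\<epsilon> < R" and "\<mu> > 0"
    and cu: "continuous_on (cball x0 (R + \<epsilon>)) u" and cv: "continuous_on (cball x0 (R + \<epsilon>)) v"
    and u: "\<And>x y. x \<in> ball x0 (R - \<epsilon>) \<Longrightarrow> y \<in> cball x \<epsilon> \<Longrightarrow> u x + \<epsilon> * \<mu> \<le> u y \<Longrightarrow>
        \<exists>z\<in>cball x (2 * \<epsilon>). 2 * u y \<le> u x + u z"
    and v: "\<And>x y. x \<in> ball x0 (R - \<epsilon>) \<Longrightarrow> y \<in> cball x \<epsilon> \<Longrightarrow>
        \<exists>z\<in>cball x (2 * \<epsilon>). v x + v z \<le> 2 * v y \<and> \<epsilon> * \<mu> \<le> v y - v z"
  obtains x y y' where "x \<in> cball x0 R - ball x0 (R - \<epsilon>)" "y \<in> cball x \<epsilon>" "y' \<in> cball x \<epsilon>"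
    "u x0 - v x0 \<le> u y - v y'"
proof -
  \<comment> \<open>Maximising over triples avoids the continuity of the sup- and inf-convolutions.\<close>
  define T where "T = (cball x0 R \<times> cball x0 (R + \<epsilon>) \<times> cball x0 (R + \<epsilon>)) \<inter>
     ({p. dist (fst p) (fst (snd p)) \<le> \<epsilon>} \<inter> {p. dist (fst p) (snd (snd p)) \<le> \<epsilon>})"
  have T: "(x, y, y') \<in> T \<longleftrightarrow> x \<in> cball x0 R \<and> y \<in> cball x \<epsilon> \<and> y' \<in> cball x \<epsilon>" for x y y'
    using dist_triangle[of x0 y x] dist_triangle[of x0 y' x] by (auto simp: T_def)
  have "compact T"
    unfolding T_def
    by (intro compact_Int_closed compact_Times compact_cball closed_Int closed_Collect_le continuous_intros)
  define F where "F p = u (fst (snd p)) - v (snd (snd p))" for p :: "'a \<times> 'a \<times> 'a"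
  have cuT: "continuous_on T (\<lambda>p. u (fst (snd p)))"
    by (rule continuous_on_compose2[OF cu]) (auto simp: T_def intro!: continuous_intros)
  have cvT: "continuous_on T (\<lambda>p. v (snd (snd p)))"
    by (rule continuous_on_compose2[OF cv]) (auto simp: T_def intro!: continuous_intros)
  have cF: "continuous_on T F"
    unfolding F_def by (intro continuous_intros cuT cvT)
  have x0T: "(x0, x0, x0) \<in> T" using R by (simp add: T)
  obtain p0 where p0: "p0 \<in> T" "\<And>p. p \<in> T \<Longrightarrow> F p \<le> F p0"
    using continuous_attains_sup[OF \<open>compact T\<close> _ cF] x0T by (metis empty_iff)
  \<comment> \<open>Among the maximisers, one with the largest value of \<open>u\<close>.\<close>
  define E where "E = T \<inter> F -` {F p0}"
  have "compact E"
  proof -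
    have "closed E"
      unfolding E_def using cF \<open>compact T\<close>
      by (intro continuous_closed_preimage) (auto simp: compact_imp_closed)
    then show ?thesis
      using compact_Int_closed[OF \<open>compact T\<close> \<open>closed E\<close>] by (simp add: E_def Int_absorb1 Int_assoc[symmetric])
  qed
  moreover have "continuous_on E (\<lambda>p. u (fst (snd p)))"
    by (rule continuous_on_subset[OF cuT]) (auto simp: E_def)
  moreover have "p0 \<in> E" using p0 by (simp add: E_def)
  ultimately obtain p where p: "p \<in> E" "\<And>q. q \<in> E \<Longrightarrow> u (fst (snd q)) \<le> u (fst (snd p))"
    using continuous_attains_sup[of E "\<lambda>p. u (fst (snd p))"] by (metis empty_iff)
  obtain x y y' where pe: "p = (x, y, y')" by (cases p) auto
  have xyT: "x \<in> cball x0 R" "y \<in> cball x \<epsilon>" "y' \<in> cball x \<epsilon>"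
    using p(1) by (auto simp: E_def pe T)
  have max: "u b - v c \<le> u y - v y'" if "a \<in> cball x0 R" "b \<in> cball a \<epsilon>" "c \<in> cball a \<epsilon>" for a b c
    using p0(2)[of "(a, b, c)"] p(1) that by (simp add: E_def pe F_def T)
  have tie: "u b \<le> u y" if "a \<in> cball x0 R" "b \<in> cball a \<epsilon>" "c \<in> cball a \<epsilon>" "u b - v c = u y - v y'" for a b c
    using p(2)[of "(a, b, c)"] p(1) that by (simp add: E_def pe F_def T)
  show ?thesis
  proof (rule that[OF _ xyT(2,3)])
    show "u x0 - v x0 \<le> u y - v y'"
      using R by (intro max[of x0]) auto
    have "x \<notin> ball x0 (R - \<epsilon>)"
    proof
      assume x: "x \<in> ball x0 (R - \<epsilon>)"
      \<comment> \<open>A point within \<open>2 * \<epsilon>\<close> of \<open>x\<close> shares with \<open>x\<close> the closed \<open>\<epsilon>\<close>-ball about their midpoint, so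
         it competes, paired with \<open>x\<close>, in the maximisation.\<close>
      have mid: "midpoint x w \<in> cball x0 R" "w \<in> cball (midpoint x w) \<epsilon>" "x \<in> cball (midpoint x w) \<epsilon>"
        if "w \<in> cball x (2 * \<epsilon>)" for w
      proof -
        have "dist x (midpoint x w) \<le> \<epsilon>" "dist (midpoint x w) w \<le> \<epsilon>"
          using that by (simp_all add: dist_midpoint)
        then show "midpoint x w \<in> cball x0 R" "w \<in> cball (midpoint x w) \<epsilon>" "x \<in> cball (midpoint x w) \<epsilon>"
          using x dist_triangle[of x0 "midpoint x w" x] by (auto simp: dist_commute)
      qed
      obtain z' where z': "z' \<in> cball x (2 * \<epsilon>)" "v x + v z' \<le> 2 * v y'" "\<epsilon> * \<mu> \<le> v y' - v z'"
        using v[OF x xyT(3)] by blast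
      have 1: "u x - v z' \<le> u y - v y'"
        using max[OF mid(1,3,2)[OF z'(1)]] .
      then obtain z where z: "z \<in> cball x (2 * \<epsilon>)" "2 * u y \<le> u x + u z"
        using u[OF x xyT(2)] z'(3) by force
      have 2: "u z - v x \<le> u y - v y'"
        using max[OF mid[OF z(1)]] .
      \<comment> \<open>The chain \<open>u z - u y \<le> v x - v y' \<le> v y' - v z' \<le> u y - u x \<le> u z - u y\<close> consists of
         equalities; hence \<open>z\<close> also belongs to a maximising triple, but \<open>u\<close> is larger there.\<close>
      have "u z \<le> u y"
        by (rule tie[OF mid[OF z(1)]]) (use 1 2 z z' in linarith)
      moreover have "\<epsilon> * \<mu> > 0" using R \<open>\<mu> > 0\<close> by simp
      ultimately show False
        using 1 2 z z' by linarith
    qed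
    then show "x \<in> cball x0 R - ball x0 (R - \<epsilon>)" using xyT by blast
  qed
qed


section \<open>Equivalence of the metric and the viscosity notions\<close>

lemma locally_lipschitz_on_imp_continuous_on:
  assumes "locally_lipschitz_on D u" "open D"
  shows "continuous_on D u"
proof (rule continuous_at_imp_continuous_on, rule ballI)
  fix x assume "x \<in> D"
  then obtain r L where r: "r > 0" "L-lipschitz_on (ball x r \<inter> D) u"
    using assms unfolding locally_lipschitz_on_def by blast
  then have "continuous_on (ball x r \<inter> D) u"
    by (simp add: lipschitz_on_continuous_on)
  then show "isCont u x"
    using \<open>x \<in> D\<close> r \<open>open D\<close> by (simp add: continuous_on_eq_continuous_at open_Int)
qed

lemma continuous_on_imp_semicontinuous:
  assumes "continuous_on D u"
  shows "lsc_on D u" "usc_on D u"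
  using assms unfolding lsc_on_def usc_on_def continuous_on_def
  by (auto intro: order_tendstoD)

lemma continuous_on_imp_locally_bounded_on:
  assumes "continuous_on D u"
  shows "locally_bounded_on D u"
  unfolding locally_bounded_on_def
proof
  fix x assume "x \<in> D"
  then obtain r where r: "r > 0" "\<And>y. y \<in> D \<Longrightarrow> dist y x < r \<Longrightarrow> dist (u y) (u x) < 1"
    using continuous_on_iff[THEN iffD1, rule_format, OF assms \<open>x \<in> D\<close> zero_less_one] by auto
  have "u ` (ball x r \<inter> D) \<subseteq> ball (u x) 1"
    using r(2) by (auto simp: dist_commute)
  then show "\<exists>r>0. bounded (u ` (ball x r \<inter> D))"
    using r(1) bounded_subset[OF bounded_ball] by blast
qed

lemma open_sublevel:
  fixes f :: "'a::topological_space \<Rightarrow> real"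
  assumes "open D" "continuous_on D f"
  shows "open {x \<in> D. f x < c}" "open {x \<in> D. c < f x}"
proof -
  have "{x \<in> D. f x < c} = D \<inter> f -` {..<c}" "{x \<in> D. c < f x} = D \<inter> f -` {c<..}"
    by auto
  then show "open {x \<in> D. f x < c}" "open {x \<in> D. c < f x}"
    using assms by (auto intro: continuous_open_preimage)
qed

theorem metric_supersolution_imp_viscosity_supersolution:
  fixes u :: "'a::euclidean_space \<Rightarrow> real"
  assumes "open \<Omega>" and u: "metric_supersolution lam \<Omega> u"
  shows "viscosity_supersolution lam \<Omega> u"
  unfolding viscosity_supersolution_def
proof (intro conjI ballI allI impI)
  have cont: "continuous_on \<Omega> u"
    using u \<open>open \<Omega>\<close> unfolding metric_supersolution_def
    by (blast intro: locally_lipschitz_on_imp_continuous_on)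
  then show "locally_bounded_on \<Omega> u" "lsc_on \<Omega> u"
    by (simp_all add: continuous_on_imp_locally_bounded_on continuous_on_imp_semicontinuous)
  fix x0 \<phi>
  assume x0: "x0 \<in> \<Omega>" and C2: "C2_on \<Omega> \<phi>"
    and min: "strict_local_min_on \<Omega> (\<lambda>x. u x - \<phi> x) x0"
  obtain g H where g: "\<And>x. x \<in> \<Omega> \<Longrightarrow> GDERIV \<phi> x :> g x"
    and H: "\<And>x. x \<in> \<Omega> \<Longrightarrow> (g has_derivative blinfun_apply (H x)) (at x)"
    using C2 unfolding C2_on_def by blast
  have "\<forall>\<^sub>F x in at x0. u x0 - \<phi> x0 < u x - \<phi> x"
    using min unfolding strict_local_min_on_def at_within_open[OF x0 \<open>open \<Omega>\<close>] by blast
  then have touch: "\<forall>\<^sub>F x in at x0. u x0 - \<phi> x0 \<le> u x - \<phi> x"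
    by eventually_elim simp
  have "ereal (lam * u x0) \<le> subslope u x0"
    using u x0 unfolding metric_supersolution_def by blast
  also have "\<dots> \<le> ereal (norm (g x0))"
    by (rule subslope_le_of_touched_below[OF g[OF x0] touch])
  finally show "lam * u x0 \<le> norm (gradient \<phi> x0)"
    by (simp add: gradient_eqI[OF g[OF x0]])
  have "infty_superharmonic \<Omega> u"
    using u unfolding metric_supersolution_def by blast
  then have "H x0 (g x0) \<bullet> g x0 \<le> 0"
    using \<open>open \<Omega>\<close> x0 g H[OF x0] touch by (rule infty_superharmonic_touched_below)
  moreover have "infty_laplacian \<phi> x0 = H x0 (g x0) \<bullet> g x0"
    using \<open>open \<Omega>\<close> x0 g H[OF x0] by (rule infty_laplacian_eqI)
  ultimately show "0 \<le> - infty_laplacian \<phi> x0"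
    by simp
qed

theorem viscosity_supersolution_imp_metric_supersolution:
  fixes u :: "'a::euclidean_space \<Rightarrow> real"
  assumes "open \<Omega>" and "lam > 0" and pos: "\<And>x. x \<in> \<Omega> \<Longrightarrow> u x > 0"
    and lip: "locally_lipschitz_on \<Omega> u" and u: "viscosity_supersolution lam \<Omega> u"
  shows "metric_supersolution lam \<Omega> u"
proof -
  note cont = locally_lipschitz_on_imp_continuous_on[OF lip \<open>open \<Omega>\<close>]
  have "bdd_below (u ` \<Omega>)"
    using pos by (auto intro!: bdd_belowI[of _ 0] less_imp_le)
  then have "infty_superharmonic \<Omega> u"
    by (rule viscosity_supersolution_imp_infty_superharmonic[OF u cont])
  moreover have "ereal (lam * u x) \<le> subslope u x" if "x \<in> \<Omega>" for x
    by (rule viscosity_supersolution_subslope_ge[OF u \<open>open \<Omega>\<close> cont that])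
       (use pos[OF that] \<open>lam > 0\<close> in simp)
  ultimately show ?thesis
    unfolding metric_supersolution_def using lip by blast
qed

lemma metric_subsolutionD:
  assumes u: "metric_subsolution lam \<Omega> u" and "x0 \<in> \<Omega>" "r > 0" "ball x0 r \<subseteq> \<Omega>"
    and "infty_superharmonic (ball x0 r) v"
    and "strict_local_max_on (ball x0 r) (\<lambda>x. u x - v x) x0"
  shows "\<exists>l. ((\<lambda>r. INF x\<in>ball x0 r. subslope v x) \<longlongrightarrow> l) (at_right 0) \<and> l \<le> ereal (lam * u x0)"
  using u[unfolded metric_subsolution_def, THEN conjunct2, THEN bspec, OF assms(2), THEN spec,
      THEN mp, OF assms(3), THEN spec, THEN mp, OF assms(4), THEN mp, OF assms(5), THEN mp, OF assms(6)] .

text \<open>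
  If both alternatives fail for \<open>\<phi>\<close> at \<open>x0\<close>, they fail nearby. Then \<open>\<phi>\<close> itself is infinity
  superharmonic on a ball with subslope at least the norm of its gradient, and is an admissible \<open>v\<close> in the metric definition.
\<close>

theorem metric_subsolution_imp_viscosity_subsolution:
  fixes u :: "'a::euclidean_space \<Rightarrow> real"
  assumes "open \<Omega>" and "lam > 0" and pos: "\<And>x. x \<in> \<Omega> \<Longrightarrow> u x > 0"
    and u: "metric_subsolution lam \<Omega> u"
  shows "viscosity_subsolution lam \<Omega> u"
  unfolding viscosity_subsolution_def
proof (intro conjI ballI allI impI)
  have cont: "continuous_on \<Omega> u"
    using u \<open>open \<Omega>\<close> unfolding metric_subsolution_def
    by (blast intro: locally_lipschitz_on_imp_continuous_on)
  then show "locally_bounded_on \<Omega> u" "usc_on \<Omega> u"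
    by (simp_all add: continuous_on_imp_locally_bounded_on continuous_on_imp_semicontinuous)
  fix x0 \<phi>
  assume x0: "x0 \<in> \<Omega>" and C2: "C2_on \<Omega> \<phi>"
    and max: "strict_local_max_on \<Omega> (\<lambda>x. u x - \<phi> x) x0"
  obtain g H where g: "\<And>x. x \<in> \<Omega> \<Longrightarrow> GDERIV \<phi> x :> g x"
    and H: "\<And>x. x \<in> \<Omega> \<Longrightarrow> (g has_derivative blinfun_apply (H x)) (at x)"
    and cH: "continuous_on \<Omega> H"
    using C2 unfolding C2_on_def by blast
  show "norm (gradient \<phi> x0) \<le> lam * u x0 \<or> - infty_laplacian \<phi> x0 \<le> 0"
  proof (rule ccontr)
    assume "\<not> ?thesis"
    moreover have "gradient \<phi> x0 = g x0"
      using g[OF x0] by (rule gradient_eqI)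
    moreover have "infty_laplacian \<phi> x0 = H x0 (g x0) \<bullet> g x0"
      using \<open>open \<Omega>\<close> x0 g H[OF x0] by (rule infty_laplacian_eqI)
    ultimately have "lam * u x0 < norm (g x0)" and neg: "H x0 (g x0) \<bullet> g x0 < 0"
      by auto
    then obtain c where c: "lam * u x0 < c" "c < norm (g x0)"
      using dense by blast
    have "c > 0"
      using c(1) mult_pos_pos[OF \<open>lam > 0\<close> pos[OF x0]] by linarith
    have cg: "continuous_on \<Omega> g"
      by (intro continuous_at_imp_continuous_on ballI has_derivative_continuous[OF H])
    have cphi: "continuous_on \<Omega> \<phi>"
      by (intro continuous_at_imp_continuous_on ballI has_derivative_continuous[OF g[unfolded gderiv_def]])
    have "open {x \<in> \<Omega>. H x (g x) \<bullet> g x < 0}"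
      by (intro open_sublevel(1) \<open>open \<Omega>\<close> continuous_on_inner blinfun.continuous_on cg cH)
    moreover have "open {x \<in> \<Omega>. c < norm (g x)}"
      by (intro open_sublevel(2) \<open>open \<Omega>\<close> continuous_on_norm cg)
    ultimately have "open ({x \<in> \<Omega>. H x (g x) \<bullet> g x < 0} \<inter> {x \<in> \<Omega>. c < norm (g x)})"
      by (rule open_Int)
    moreover have "x0 \<in> {x \<in> \<Omega>. H x (g x) \<bullet> g x < 0} \<inter> {x \<in> \<Omega>. c < norm (g x)}"
      using x0 neg c by simp
    ultimately obtain r where r: "r > 0"
      "cball x0 r \<subseteq> {x \<in> \<Omega>. H x (g x) \<bullet> g x < 0} \<inter> {x \<in> \<Omega>. c < norm (g x)}"
      unfolding open_contains_cball by blast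
    then have near: "x \<in> \<Omega> \<and> H x (g x) \<bullet> g x < 0 \<and> c < norm (g x)" if "dist x0 x \<le> r" for x
      using that by (auto simp: subset_iff)
    have sub: "cball x0 r \<subseteq> \<Omega>" "ball x0 r \<subseteq> \<Omega>"
      using near by auto
    have "compact (\<phi> ` cball x0 r)"
      by (intro compact_continuous_image compact_cball continuous_on_subset[OF cphi] sub)
    then have "bdd_below (\<phi> ` cball x0 r)"
      by (intro bounded_imp_bdd_below compact_imp_bounded)
    then have "bdd_below (\<phi> ` ball x0 r)"
      by (rule bdd_below_mono) (intro image_mono ball_subset_cball)
    then have "infty_superharmonic (ball x0 r) \<phi>"
    proof (rule infty_superharmonic_of_smooth[OF open_ball])
      fix x assume "x \<in> ball x0 r"
      then show "GDERIV \<phi> x :> g x" "(g has_derivative blinfun_apply (H x)) (at x)"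
        "H x (g x) \<bullet> g x < 0"
        using g[of x] H[of x] near[of x] by simp_all
    qed
    moreover have "strict_local_max_on (ball x0 r) (\<lambda>x. u x - \<phi> x) x0"
      using max r(1) unfolding strict_local_max_on_def at_within_open[OF x0 \<open>open \<Omega>\<close>]
      by (simp add: at_within_open[OF _ open_ball])
    ultimately obtain l where
      l: "((\<lambda>\<rho>. INF x\<in>ball x0 \<rho>. subslope \<phi> x) \<longlongrightarrow> l) (at_right 0)" "l \<le> ereal (lam * u x0)"
      using metric_subsolutionD[OF u x0 r(1) sub(2)] by blast
    have "ereal c \<le> l"
    proof (rule tendsto_lowerbound[OF l(1)])
      have "\<forall>\<^sub>F \<rho> in at_right 0. \<rho> < r"
        by (rule eventually_at_rightI[of 0 r]) (use r(1) in auto)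
      then show "\<forall>\<^sub>F \<rho> in at_right 0. ereal c \<le> (INF x\<in>ball x0 \<rho>. subslope \<phi> x)"
      proof eventually_elim
        case (elim \<rho>)
        show ?case
        proof (rule INF_greatest)
          fix x assume "x \<in> ball x0 \<rho>"
          then have "x \<in> \<Omega>" "c < norm (g x)" using near[of x] elim by auto
          then show "ereal c \<le> subslope \<phi> x"
            using subslope_ge_norm_gradient[OF g, of x] \<open>c > 0\<close>
            by (cases "g x = 0") (auto intro: order_trans[of "ereal c" "ereal (norm (g x))"])
        qed
      qed
    qed simp
    then show False
      using order_trans[OF _ l(2), of "ereal c"] c(1) by simp
  qed
qed

text \<open>
  Suppose the subslope of \<open>v\<close> stays above some \<open>\<mu> > lam * u x0\<close> near \<open>x0\<close>. Then \<open>v\<close> decreases at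
  rate at least \<open>\<mu>\<close> everywhere, and \<open>u\<close> obeys comparison with steep cones from above. By
  \<open>max_displacement_near_boundary\<close> the difference \<open>u - v\<close> cannot have a strict maximum at \<open>x0\<close>.
\<close>

theorem viscosity_subsolution_imp_metric_subsolution:
  fixes u :: "'a::euclidean_space \<Rightarrow> real"
  assumes "open \<Omega>" and "lam > 0" and pos: "\<And>x. x \<in> \<Omega> \<Longrightarrow> u x > 0"
    and lip: "locally_lipschitz_on \<Omega> u" and u: "viscosity_subsolution lam \<Omega> u"
  shows "metric_subsolution lam \<Omega> u"
  unfolding metric_subsolution_def
proof (intro conjI ballI allI impI lip)
  fix x0 v and r0 :: real
  assume x0: "x0 \<in> \<Omega>" and r0: "r0 > 0" "ball x0 r0 \<subseteq> \<Omega>"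
    and v: "infty_superharmonic (ball x0 r0) v"
    and max: "strict_local_max_on (ball x0 r0) (\<lambda>x. u x - v x) x0"
  define I where "I r = (INF x\<in>ball x0 r. subslope v x)" for r
  define l where "l = (SUP r\<in>{0<..}. I r)"
  \<comment> \<open>The infima increase as the balls shrink, so their limit is the supremum.\<close>
  have I_mono: "I s \<le> I r" if "r \<le> s" for r s
    unfolding I_def by (rule INF_superset_mono) (use that in auto)
  have "(I \<longlongrightarrow> l) (at_right 0)"
  proof (rule order_tendstoI)
    fix a assume "a < l"
    then obtain s where s: "s > 0" "a < I s"
      unfolding l_def less_SUP_iff by auto
    have "\<forall>\<^sub>F r in at_right 0. r \<le> s"
      using s(1) eventually_at_right_field less_imp_le by blast
    then show "\<forall>\<^sub>F r in at_right 0. a < I r"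
      by eventually_elim (use s I_mono in \<open>meson less_le_trans\<close>)
  next
    fix a assume "l < a"
    have "\<forall>\<^sub>F r in at_right (0::real). 0 < r"
      by (rule eventually_at_right_less)
    then show "\<forall>\<^sub>F r in at_right 0. I r < a"
      by eventually_elim
         (use \<open>l < a\<close> in \<open>auto simp: l_def intro: le_less_trans[OF SUP_upper]\<close>)
  qed
  moreover have "l \<le> ereal (lam * u x0)"
  proof (rule ccontr)
    assume "\<not> ?thesis"
    then obtain \<rho> where \<rho>: "\<rho> > 0" "ereal (lam * u x0) < I \<rho>"
      unfolding not_le l_def less_SUP_iff by auto
    then obtain \<mu>' where "ereal (lam * u x0) < \<mu>'" "\<mu>' < I \<rho>"
      using dense by blast
    then obtain \<mu> where \<mu>: "lam * u x0 < \<mu>" "ereal \<mu> < I \<rho>"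
      by (cases \<mu>') auto
    \<comment> \<open>Three levels between \<open>lam * u x0\<close> and the subslope of \<open>v\<close>: \<open>lam * u\<close> stays below \<open>\<mu>1\<close>
       near \<open>x0\<close>, cones of slope at least \<open>\<mu>2\<close> are then admissible for \<open>u\<close>, and the gap between
       \<open>\<mu>2\<close> and \<open>\<mu>\<close> shows that an increase of \<open>u\<close> by \<open>\<epsilon> * \<mu>\<close> is not explained by the
       slope \<open>\<mu>2\<close> alone.\<close>
    obtain \<mu>1 where \<mu>1: "lam * u x0 < \<mu>1" "\<mu>1 < \<mu>"
      using dense[OF \<mu>(1)] by blast
    obtain \<mu>2 where \<mu>2: "\<mu>1 < \<mu>2" "\<mu>2 < \<mu>"
      using dense[OF \<mu>1(2)] by blast
    have \<mu>pos: "\<mu>1 > 0"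
      using \<mu>1(1) mult_pos_pos[OF \<open>lam > 0\<close> pos[OF x0]] by linarith
    have cu: "continuous_on \<Omega> u"
      by (rule locally_lipschitz_on_imp_continuous_on[OF lip \<open>open \<Omega>\<close>])
    have cv: "continuous_on (ball x0 r0) v"
      by (rule infty_superharmonic_continuous_on[OF v open_ball])
    obtain r1 where r1: "r1 > 0" "\<And>x. dist x0 x \<le> r1 \<Longrightarrow> x \<in> ball x0 r0 \<and> x \<in> ball x0 \<rho> \<and> lam * u x < \<mu>1"
    proof -
      have "open {x \<in> \<Omega>. lam * u x < \<mu>1}"
        by (intro open_sublevel(1) \<open>open \<Omega>\<close> continuous_on_mult_left cu)
      then have "open (ball x0 r0 \<inter> ball x0 \<rho> \<inter> {x \<in> \<Omega>. lam * u x < \<mu>1})"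
        by (intro open_Int open_ball)
      moreover have "x0 \<in> ball x0 r0 \<inter> ball x0 \<rho> \<inter> {x \<in> \<Omega>. lam * u x < \<mu>1}"
        using x0 r0 \<rho> \<mu>1 by simp
      ultimately obtain r1 where "r1 > 0" "cball x0 r1 \<subseteq> ball x0 r0 \<inter> ball x0 \<rho> \<inter> {x \<in> \<Omega>. lam * u x < \<mu>1}"
        using open_contains_cball by metis
      then show thesis by (intro that[of r1]) auto
    qed
    obtain r2 where r2: "r2 > 0" "\<And>x. x \<noteq> x0 \<Longrightarrow> dist x x0 < r2 \<Longrightarrow> u x - v x < u x0 - v x0"
    proof -
      have "\<forall>\<^sub>F x in at x0. u x - v x < u x0 - v x0"
        using max r0(1) by (simp add: strict_local_max_on_def at_within_open[OF _ open_ball])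
      then show thesis
        using that unfolding eventually_at by auto
    qed
    define R where "R = min r1 (r2 / 2) / 2"
    have R: "R > 0" "2 * R \<le> r1" "2 * R < r2" using r1 r2 by (auto simp: R_def)
    have cuR: "continuous_on (cball x0 (2 * R)) u"
      by (rule continuous_on_subset[OF cu]) (use r1(2) r0(2) R in auto)
    have cvR: "continuous_on (cball x0 (2 * R)) v"
      by (rule continuous_on_subset[OF cv]) (use r1(2) R in auto)
    \<comment> \<open>By compactness the strict maximum of \<open>u - v\<close> at \<open>x0\<close> has a margin \<open>\<delta>\<close> on an annulus.\<close>
    define N where "N = cball x0 (2 * R) - ball x0 (R / 2)"
    obtain \<delta> where \<delta>: "\<delta> > 0" "\<And>x. x \<in> N \<Longrightarrow> u x - v x \<le> u x0 - v x0 - \<delta>"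
    proof (cases "N = {}")
      case True
      then show thesis using that[of 1] by simp
    next
      case False
      have "compact N" unfolding N_def by (intro compact_diff compact_cball open_ball)
      moreover have "continuous_on N (\<lambda>x. u x - v x)"
        by (intro continuous_intros continuous_on_subset[OF cuR] continuous_on_subset[OF cvR])
           (auto simp: N_def)
      ultimately obtain w where w: "w \<in> N" "\<And>x. x \<in> N \<Longrightarrow> u x - v x \<le> u w - v w"
        using continuous_attains_sup[of N "\<lambda>x. u x - v x"] False by blast
      have "u w - v w < u x0 - v x0"
        using w(1) R by (intro r2(2)) (auto simp: N_def dist_commute)
      then show thesis
        using that[of "u x0 - v x0 - (u w - v w)"] w(2) by simp
    qed
    have "uniformly_continuous_on (cball x0 (2 * R)) v"
      by (rule compact_uniformly_continuous[OF cvR compact_cball])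
    then obtain d where d: "d > 0"
      "\<And>x y. x \<in> cball x0 (2 * R) \<Longrightarrow> y \<in> cball x0 (2 * R) \<Longrightarrow> dist y x < d \<Longrightarrow> dist (v y) (v x) < \<delta>"
      by (rule uniformly_continuous_onE[OF _ \<delta>(1)]) blast
    \<comment> \<open>The bound by \<open>R / 4\<close> keeps points within \<open>\<epsilon>\<close> of the boundary strip inside the annulus
       \<open>N\<close>; the bound by \<open>d / 3\<close> makes \<open>v\<close> oscillate by less than \<open>\<delta>\<close> over distances up to
       \<open>2 * \<epsilon>\<close>.\<close>
    define \<epsilon> where "\<epsilon> = min (R / 4) (d / 3)"
    have \<epsilon>: "\<epsilon> > 0" "\<epsilon> \<le> R / 4" "2 * \<epsilon> < d" using R d by (auto simp: \<epsilon>_def)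
    have ball: "w \<in> cball x0 (2 * R)" if "x \<in> cball x0 R" "w \<in> cball x (2 * \<epsilon>)" for x w
      using that \<epsilon> dist_triangle[of x0 w x] by auto
    have sub: "cball x (2 * \<epsilon>) \<subseteq> \<Omega>" "cball x (2 * \<epsilon>) \<subseteq> ball x0 r0"
      "\<And>w. w \<in> cball x (2 * \<epsilon>) \<Longrightarrow> lam * u w \<le> \<mu>1"
      "\<And>w. w \<in> cball x (2 * \<epsilon>) \<Longrightarrow> ereal \<mu> \<le> subslope v w"
      if "x \<in> ball x0 (R - \<epsilon>)" for x
    proof -
      have *: "w \<in> ball x0 r0 \<and> w \<in> ball x0 \<rho> \<and> lam * u w < \<mu>1" if "w \<in> cball x (2 * \<epsilon>)" for w
        using ball[of x w] that \<open>x \<in> ball x0 (R - \<epsilon>)\<close> \<epsilon> R by (intro r1(2)) auto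
      then show "cball x (2 * \<epsilon>) \<subseteq> \<Omega>" "cball x (2 * \<epsilon>) \<subseteq> ball x0 r0"
        "\<And>w. w \<in> cball x (2 * \<epsilon>) \<Longrightarrow> lam * u w \<le> \<mu>1"
        using r0(2) by (auto intro: less_imp_le)
      show "ereal \<mu> \<le> subslope v w" if "w \<in> cball x (2 * \<epsilon>)" for w
      proof -
        have "I \<rho> \<le> subslope v w"
          unfolding I_def using *[OF that] by (intro INF_lower) auto
        then show ?thesis using \<mu>(2) by simp
      qed
    qed
    have sub': "cball x (2 * \<epsilon>) \<subseteq> cball x0 (2 * R)" if "x \<in> ball x0 (R - \<epsilon>)" for x
      using ball[of x] that \<epsilon> by auto
    obtain x y y' where xy: "x \<in> cball x0 R - ball x0 (R - \<epsilon>)" "y \<in> cball x \<epsilon>" "y' \<in> cball x \<epsilon>"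
      "u x0 - v x0 \<le> u y - v y'"
    proof (rule max_displacement_near_boundary[of \<epsilon> R \<mu> x0 u v])
      show "0 < \<epsilon>" "\<epsilon> < R" "\<mu> > 0" using \<epsilon> R \<mu>pos \<mu>1 by auto
      have "cball x0 (R + \<epsilon>) \<subseteq> cball x0 (2 * R)"
        using \<epsilon> R by auto
      then show "continuous_on (cball x0 (R + \<epsilon>)) u" "continuous_on (cball x0 (R + \<epsilon>)) v"
        using continuous_on_subset[OF cuR] continuous_on_subset[OF cvR] by blast+
    next
      fix x y assume x: "x \<in> ball x0 (R - \<epsilon>)" and y: "y \<in> cball x \<epsilon>" and big: "u x + \<epsilon> * \<mu> \<le> u y"
      have cux: "continuous_on (cball x (2 * \<epsilon>)) u"
        by (rule continuous_on_subset[OF cuR sub'[OF x]])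
      obtain z where z: "z \<in> cball x (2 * \<epsilon>)" "\<And>w. w \<in> cball x (2 * \<epsilon>) \<Longrightarrow> u w \<le> u z"
        using continuous_attains_sup[OF compact_cball _ cux] \<epsilon> by auto
      \<comment> \<open>The slope of the cone is the difference quotient of \<open>u\<close> over radius \<open>2 * \<epsilon>\<close>, raised to
         \<open>\<mu>2\<close> if necessary; the assumed increase of \<open>u\<close> rules out the second alternative.\<close>
      define b where "b = Max {\<mu>2, (u z - u x) / (2 * \<epsilon>)}"
      have b: "\<mu>2 \<le> b" "(u z - u x) / (2 * \<epsilon>) \<le> b" "b = \<mu>2 \<or> b = (u z - u x) / (2 * \<epsilon>)"
        by (auto simp: b_def max_def)
      have "u y \<le> u x + b * dist x y"
      proof (rule viscosity_subsolution_cone_bound[OF u cux sub(1)[OF x] _ sub(3)[OF x]])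
        show "u w \<le> u x + b * (2 * \<epsilon>)" if "dist x w = 2 * \<epsilon>" for w
          using z(2)[of w] that b(2) \<epsilon> by (simp add: pos_divide_le_eq)
      qed (use \<epsilon> \<mu>pos \<mu>2 b y in auto)
      also have "\<dots> \<le> u x + b * \<epsilon>"
        using y b \<mu>2 \<mu>pos by (intro add_left_mono mult_left_mono) auto
      finally have le: "u y \<le> u x + b * \<epsilon>" .
      have "b \<noteq> \<mu>2"
      proof
        assume "b = \<mu>2"
        then have "b * \<epsilon> < \<epsilon> * \<mu>" using \<mu>2 \<epsilon> by simp
        then show False using le big by simp
      qed
      then have "b * \<epsilon> = (u z - u x) / 2" using b(3) \<epsilon> by simp
      then show "\<exists>z\<in>cball x (2 * \<epsilon>). 2 * u y \<le> u x + u z"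
        using le z(1) by (intro bexI[of _ z]) auto
    next
      fix x y assume x: "x \<in> ball x0 (R - \<epsilon>)" and y: "y \<in> cball x \<epsilon>"
      have cvx: "continuous_on (cball x (2 * \<epsilon>)) v"
        by (rule continuous_on_subset[OF cvR sub'[OF x]])
      obtain z where z: "z \<in> cball x (2 * \<epsilon>)" "\<And>w. w \<in> cball x (2 * \<epsilon>) \<Longrightarrow> v z \<le> v w"
        using continuous_attains_inf[OF compact_cball _ cvx] \<epsilon> by auto
      have "v x - (v x - v z) / (2 * \<epsilon>) * dist x y \<le> v y"
        using \<epsilon> y by (intro infty_superharmonic_cone_bound[OF v sub(2)[OF x]] z(2)) auto
      moreover have "(v x - v z) / (2 * \<epsilon>) * dist x y \<le> (v x - v z) / (2 * \<epsilon>) * \<epsilon>"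
        using \<epsilon> y z(2)[of x] by (intro mult_left_mono) auto
      ultimately have "v x + v z \<le> 2 * v y"
        using \<epsilon> by simp
      moreover have "\<epsilon> * \<mu> \<le> v y - v z"
      proof -
        have cy: "cball y \<epsilon> \<subseteq> cball x (2 * \<epsilon>)"
        proof
          fix w assume "w \<in> cball y \<epsilon>"
          then show "w \<in> cball x (2 * \<epsilon>)"
            using y dist_triangle[of x w y] by simp
        qed
        have "ereal \<mu> \<le> subslope v y"
          using y \<epsilon> by (intro sub(4)[OF x]) auto
        also have "\<dots> \<le> ereal ((v y - v z) / \<epsilon>)"
        proof (rule subslope_le_difference_quotient[OF v _ \<epsilon>(1)])
          show "cball y \<epsilon> \<subseteq> ball x0 r0" using cy sub(2)[OF x] by blast
          show "v z \<le> v y" using y \<epsilon> by (intro z(2)) auto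
          show "v z \<le> v w" if "dist y w = \<epsilon>" for w
            using cy that by (intro z(2)) auto
        qed
        finally show ?thesis using \<epsilon> by (simp add: pos_le_divide_eq mult.commute)
      qed
      ultimately show "\<exists>z\<in>cball x (2 * \<epsilon>). v x + v z \<le> 2 * v y \<and> \<epsilon> * \<mu> \<le> v y - v z"
        using z(1) by blast
    qed
    \<comment> \<open>The maximum in the strip contradicts the margin \<open>\<delta>\<close> on the annulus.\<close>
    have xR: "x \<in> cball x0 R" using xy by blast
    have yN: "y \<in> cball x0 (2 * R)" "y' \<in> cball x0 (2 * R)"
      using ball[OF xR] xy(2,3) \<epsilon> by auto
    have "y \<in> N"
      using xy(1,2) yN(1) \<epsilon> dist_triangle[of x0 x y] by (auto simp: N_def dist_commute)
    moreover have "dist y y' < d"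
      using xy(2,3) \<epsilon> dist_triangle[of y y' x] by (auto simp: dist_commute)
    ultimately show False
      using \<delta>(2)[of y] d(2)[OF yN(2,1)] xy(4) by (auto simp: dist_real_def)
  qed
  ultimately show "\<exists>l. ((\<lambda>r. INF x\<in>ball x0 r. subslope v x) \<longlongrightarrow> l) (at_right 0) \<and> l \<le> ereal (lam * u x0)"
    unfolding I_def by blast
qed

theorem theorem4p3:
  fixes \<Omega> :: "(real ^ 'n) set" and lam :: real and u :: "real ^ 'n \<Rightarrow> real"
  assumes "open \<Omega>" and "connected \<Omega>" and "\<Omega> \<noteq> {}" and "bounded \<Omega>"
    and "lam > 0"
    and "\<And>x. x \<in> \<Omega> \<Longrightarrow> u x > 0"
    and "locally_lipschitz_on \<Omega> u"
  shows "metric_solution lam \<Omega> u \<longleftrightarrow> viscosity_solution lam \<Omega> u"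
proof
  assume "metric_solution lam \<Omega> u"
  then show "viscosity_solution lam \<Omega> u"
    unfolding metric_solution_def viscosity_solution_def
    using assms locally_lipschitz_on_imp_continuous_on
      metric_supersolution_imp_viscosity_supersolution
      metric_subsolution_imp_viscosity_subsolution by blast
next
  assume "viscosity_solution lam \<Omega> u"
  then show "metric_solution lam \<Omega> u"
    unfolding metric_solution_def viscosity_solution_def
    using assms viscosity_supersolution_imp_metric_supersolution
      viscosity_subsolution_imp_metric_subsolution by blast
qed

end
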